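(* Let $1\le p<+\infty$ and let $w=(w_k)_{k\in\mathbb N}$ and $w'=(w'_k)_{k\in\mathbb N}$ be sequences of positive weights such that $B_w$ and $B_{w'}$ are two bounded frequently hypercyclic weighted shifts on $\ell^p$. Assume that there is an infinite set $A\subset\mathbb N$ with infinite complement $A^c=\mathbb N\setminus A$ such that $\frac{\prod_{k=1}^nw_k}{\prod_{k=1}^nw'_k}$ tends to some $a\neq0$ as $n$ tends to infinity in $A$, and that there exists $\eta>0$ with $|a|-\eta>0$ such that $\Big|\frac{\prod_{k=1}^nw_k}{\prod_{k=1}^nw'_k}-a\Big|>\eta$ for all sufficiently large $n\in A^c$. Assume moreover that for every finite sequence $(b_i)_{i=0}^k\subset\{0,1\}$ containing at least one zero, $$\underline d\big(\{n\in\mathbb N:\ \forall\,0\le i\le k,\ n+i\in A\text{ if and only if }b_i=0\}\big)>0 .$$ Then there exists $x\in FHC(B_w)$ such that $x\notin HC(B_{w'})$.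
   Context: $\ell^p=\ell^p(\mathbb N_0)$. The weighted backward shift is $B_w(x_0,x_1,x_2,\dots)=(w_1x_1,w_2x_2,w_3x_3,\dots)$. For $E\subset\mathbb N_0$, $\underline d(E)=\liminf_{n\to\infty}\frac{\#(E\cap[0,n])}{n+1}$. $HC(T)$ is the set of vectors $u$ whose orbit $\{T^nu:n\in\mathbb N_0\}$ is dense. $FHC(T)$ is the set of vectors $u$ with $\underline d(\{k\in\mathbb N_0:T^ku\in U\})>0$ for every non-empty open set $U$; $T$ is frequently hypercyclic if $FHC(T)\neq\varnothing$. *)

theory Defs
  imports "HOL-Analysis.Analysis"
begin

text \<open>
  The scalars range over an arbitrary \<open>real_normed_field\<close>. Up to isometric isomorphism the only
  such fields are the reals and the complex numbers (Gelfand-Mazur), so this covers exactly the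
  real and the complex space \<open>\<ell>\<^sup>p\<close>.
\<close>

definition lp :: "real \<Rightarrow> (nat \<Rightarrow> 'a::real_normed_field) set" where
  "lp p = {x. summable (\<lambda>n. norm (x n) powr p)}"

definition lp_norm :: "real \<Rightarrow> (nat \<Rightarrow> 'a::real_normed_field) \<Rightarrow> real" where
  "lp_norm p x = (\<Sum>n. norm (x n) powr p) powr (1 / p)"

definition lp_dist :: "real \<Rightarrow> (nat \<Rightarrow> 'a::real_normed_field) \<Rightarrow> (nat \<Rightarrow> 'a) \<Rightarrow> real" where
  "lp_dist p x y = lp_norm p (\<lambda>n. x n - y n)"

definition lp_topology :: "real \<Rightarrow> (nat \<Rightarrow> 'a::real_normed_field) topology" where
  "lp_topology p = Metric_space.mtopology (lp p) (lp_dist p)"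

text \<open>Operators are functions on all scalar sequences, of which only the restriction to \<open>lp p\<close>
  matters; boundedness includes that this restriction is a self-map of \<open>lp p\<close>. Linearity is not
  part of the definition, as it is only applied to weighted shifts.\<close>

definition lp_bounded :: "real \<Rightarrow> ((nat \<Rightarrow> 'a::real_normed_field) \<Rightarrow> nat \<Rightarrow> 'a) \<Rightarrow> bool" where
  "lp_bounded p T \<longleftrightarrow> T ` lp p \<subseteq> lp p \<and> (\<exists>C. \<forall>x\<in>lp p. lp_norm p (T x) \<le> C * lp_norm p x)"

text \<open>The weights are indexed from 1; the value \<open>w 0\<close> is never used.\<close>

definition weighted_shift :: "(nat \<Rightarrow> real) \<Rightarrow> (nat \<Rightarrow> 'a::real_normed_field) \<Rightarrow> nat \<Rightarrow> 'a" where
  "weighted_shift w x = (\<lambda>n. w (Suc n) *\<^sub>R x (Suc n))"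

definition lower_density :: "nat set \<Rightarrow> ereal" where
  "lower_density E = liminf (\<lambda>n. ereal (real (card (E \<inter> {0..n})) / real (n + 1)))"

definition HC :: "real \<Rightarrow> ((nat \<Rightarrow> 'a::real_normed_field) \<Rightarrow> nat \<Rightarrow> 'a) \<Rightarrow> (nat \<Rightarrow> 'a) set" where
  "HC p T = {u \<in> lp p. lp_topology p closure_of {(T ^^ n) u | n. True} = lp p}"

definition FHC :: "real \<Rightarrow> ((nat \<Rightarrow> 'a::real_normed_field) \<Rightarrow> nat \<Rightarrow> 'a) \<Rightarrow> (nat \<Rightarrow> 'a) set" where
  "FHC p T = {u \<in> lp p. \<forall>U. openin (lp_topology p) U \<and> U \<noteq> {} \<longrightarrow>
     lower_density {k. (T ^^ k) u \<in> U} > 0}"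

definition frequently_hypercyclic ::
    "real \<Rightarrow> ((nat \<Rightarrow> 'a::real_normed_field) \<Rightarrow> nat \<Rightarrow> 'a) \<Rightarrow> bool" where
  "frequently_hypercyclic p T \<longleftrightarrow> FHC p T \<noteq> {}"

text \<open>\<open>lp p\<close> with \<open>lp_dist p\<close> is a metric space for \<open>p \<ge> 1\<close>, so \<open>lp_topology p\<close> is its norm
  topology.\<close>

lemma powr_convex_nonneg:
  fixes p u v s t :: real
  assumes "1 \<le> p" "0 < u" "0 < v" "u + v = 1" "0 \<le> s" "0 \<le> t"
  shows "(u * s + v * t) powr p \<le> u * s powr p + v * t powr p"
proof -
  have le: "c powr p \<le> c" if "0 < c" "c \<le> 1" for c :: real
    using that assms(1) powr_mono'[of 1 p c] by simp
  consider "s = 0" | "t = 0" | "0 < s" "0 < t"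
    using assms by linarith
  then show ?thesis
  proof cases
    case 1
    then show ?thesis
      using assms le[of v] by (auto simp: powr_mult mult_right_mono)
  next
    case 2
    then show ?thesis
      using assms le[of u] by (auto simp: powr_mult mult_right_mono)
  next
    case 3
    have u: "u = 1 - v"
      using assms by simp
    show ?thesis
      using convex_onD[OF powr_convex[OF assms(1)], of v s t] assms 3 unfolding u by simp
  qed
qed

lemma lp_norm_nonneg [simp]: "0 \<le> lp_norm p x"
  by (simp add: lp_norm_def)

lemma lp_norm_powr:
  assumes "1 \<le> p" "x \<in> lp p"
  shows "lp_norm p x powr p = (\<Sum>n. norm (x n) powr p)"
proof -
  have "0 \<le> (\<Sum>n. norm (x n) powr p)"
    using assms by (auto simp: lp_def intro!: suminf_nonneg)
  then show ?thesis
    using assms by (simp add: lp_norm_def powr_powr)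
qed

lemma lp_norm_eq_0_iff:
  assumes "1 \<le> p" "x \<in> lp p"
  shows "lp_norm p x = 0 \<longleftrightarrow> (\<forall>n. x n = 0)"
  using assms suminf_eq_zero_iff[of "\<lambda>n. norm (x n) powr p"] by (auto simp: lp_norm_def lp_def)

lemma lp_minkowski:
  assumes p: "1 \<le> p" and x: "x \<in> lp p" and y: "y \<in> lp p"
  shows "(\<lambda>n. x n + y n) \<in> lp p \<and> lp_norm p (\<lambda>n. x n + y n) \<le> lp_norm p x + lp_norm p y"
proof -
  define a b where "a = lp_norm p x" and "b = lp_norm p y"
  consider "a = 0" | "b = 0" | "0 < a" "0 < b"
    using lp_norm_nonneg[of p x] lp_norm_nonneg[of p y] unfolding a_def b_def by linarith
  then show ?thesis
  proof cases
    case 1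
    then have "x n = 0" for n using lp_norm_eq_0_iff[OF p x] by (simp add: a_def)
    then show ?thesis using y by simp
  next
    case 2
    then have "y n = 0" for n using lp_norm_eq_0_iff[OF p y] by (simp add: b_def)
    then show ?thesis using x by simp
  next
    case 3
    define g where "g n = (a + b) powr p *
      (a / (a + b) * (norm (x n) powr p / a powr p) + b / (a + b) * (norm (y n) powr p / b powr p))"
      for n
    have le: "norm (x n + y n) powr p \<le> g n" for n
    proof -
      have "norm (x n + y n) powr p \<le> (norm (x n) + norm (y n)) powr p"
        using p by (intro powr_mono2 norm_triangle_ineq) auto
      also have "norm (x n) + norm (y n) =
          (a + b) * (a / (a + b) * (norm (x n) / a) + b / (a + b) * (norm (y n) / b))"
      proof -
        have "(a + b) * (a / (a + b) * (norm (x n) / a)) = norm (x n)"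
          "(a + b) * (b / (a + b) * (norm (y n) / b)) = norm (y n)"
          using 3 by auto
        then show ?thesis by (simp only: distrib_left)
      qed
      also have "\<dots> powr p = (a + b) powr p *
          (a / (a + b) * (norm (x n) / a) + b / (a + b) * (norm (y n) / b)) powr p"
        using 3 by (intro powr_mult)
      also have "\<dots> \<le> (a + b) powr p * (a / (a + b) * (norm (x n) / a) powr p
          + b / (a + b) * (norm (y n) / b) powr p)"
        using 3 p by (intro mult_left_mono powr_convex_nonneg)
          (auto simp: add_divide_distrib[symmetric])
      also have "\<dots> = g n"
        using 3 by (simp add: g_def powr_divide)
      finally show ?thesis .
    qed
    have "(\<lambda>n. norm (x n) powr p) sums (a powr p)" "(\<lambda>n. norm (y n) powr p) sums (b powr p)"
      using x y lp_norm_powr[OF p x] lp_norm_powr[OF p y]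
      by (auto simp: lp_def a_def b_def summable_sums)
    then have "g sums ((a + b) powr p *
        (a / (a + b) * (a powr p / a powr p) + b / (a + b) * (b powr p / b powr p)))"
      unfolding g_def by (intro sums_mult sums_add sums_divide)
    also have "(a + b) powr p *
        (a / (a + b) * (a powr p / a powr p) + b / (a + b) * (b powr p / b powr p)) = (a + b) powr p"
      using 3 by (simp add: add_divide_distrib[symmetric])
    finally have g: "g sums ((a + b) powr p)" .
    have s: "summable (\<lambda>n. norm (x n + y n) powr p)"
      by (rule summable_comparison_test'[OF sums_summable[OF g], of 0]) (use le in auto)
    have "(\<Sum>n. norm (x n + y n) powr p) \<le> (a + b) powr p"
      using suminf_le[OF le s sums_summable[OF g]] sums_unique[OF g] by simp
    then have "lp_norm p (\<lambda>n. x n + y n) \<le> ((a + b) powr p) powr (1 / p)"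
      unfolding lp_norm_def using p s by (intro powr_mono2) (auto intro!: suminf_nonneg)
    also have "\<dots> = a + b"
      using 3 p by (simp add: powr_powr)
    finally show ?thesis
      using s by (simp add: lp_def a_def b_def)
  qed
qed

lemma lp_diff:
  assumes "1 \<le> p" "x \<in> lp p" "y \<in> lp p"
  shows "(\<lambda>n. x n - y n) \<in> lp p"
  using lp_minkowski[of p x "\<lambda>n. - y n"] assms by (simp add: lp_def)

lemma Metric_space_lp:
  assumes p: "1 \<le> p"
  shows "Metric_space (lp p) (lp_dist p)"
proof
  show "0 \<le> lp_dist p x y" for x y :: "nat \<Rightarrow> 'a"
    by (simp add: lp_dist_def)
  show "lp_dist p x y = lp_dist p y x" for x y :: "nat \<Rightarrow> 'a"
    by (simp add: lp_dist_def lp_norm_def norm_minus_commute)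
next
  fix x y :: "nat \<Rightarrow> 'a" assume "x \<in> lp p" "y \<in> lp p"
  then show "lp_dist p x y = 0 \<longleftrightarrow> x = y"
    using lp_norm_eq_0_iff[OF p lp_diff[OF p]] by (auto simp: lp_dist_def)
next
  fix x y z :: "nat \<Rightarrow> 'a" assume "x \<in> lp p" "y \<in> lp p" "z \<in> lp p"
  then show "lp_dist p x z \<le> lp_dist p x y + lp_dist p y z"
    using lp_minkowski[OF p lp_diff[OF p, of x y] lp_diff[OF p, of y z]]
    by (simp add: lp_dist_def)
qed

end

theory Submission
  imports Defs
begin

text \<open>
  Let \<open>W n = w 1 * ... * w n\<close>, let \<open>W' n\<close> be the same product for \<open>w'\<close>, and \<open>R n = W n / W' n\<close>. A vector
  is sought in the form \<open>x m = c m / W m\<close>. Coordinate \<open>j\<close> of its \<open>n\<close>-th iterate under the shift of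
  \<open>w\<close> is \<open>c (n + j) / W j\<close>, and coordinate \<open>0\<close> of its \<open>n\<close>-th iterate under the shift of \<open>w'\<close> is
  \<open>c n / R n\<close>. So the first orbit comes close to every finite sequence as soon as \<open>c\<close> contains every
  block of values, frequently and followed by many zeros; and the second orbit stays away from the
  unit vector \<open>e\<^sub>0\<close> as soon as \<open>c n / R n\<close> stays away from \<open>1\<close>.

  The set \<open>A\<close> makes the two requirements compatible. On \<open>A\<close> the ratio \<open>R n\<close> is nearly \<open>a\<close>, and off \<open>A\<close>
  it is at distance more than \<open>\<eta>\<close> from \<open>a\<close>. A value within \<open>\<eta> / 2\<close> of \<open>a\<close> may therefore be put at
  positions off \<open>A\<close>, and any other value at positions in \<open>A\<close>
  (\<open>relative_distance_lower_bound\<close>). For a given block this prescribes the pattern of \<open>A\<close> along the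
  block; requiring also that the position right after the block lies in \<open>A\<close>, the pattern
  contains a zero, and by hypothesis its occurrences have positive lower density.

  It remains to build a frequently hypercyclic vector whose blocks occur only at positions prescribed
  in this way (\<open>FHC_vector_with_prescribed_positions\<close>). This uses four facts.
  The first is the theorem of Bayart and Ruzsa that a frequently hypercyclic weighted shift satisfies
  \<open>\<Sum>n. 1 / W n powr p < \<infinity>\<close> (\<open>FHC_shift_imp_summable\<close>), which rests on a combinatorial property of
  difference sets (\<open>summable_if_bounded_return_sums\<close>).
  The second is that countably many sets of positive lower density can be thinned out to sets that
  still have positive lower density and are as separated as desired (\<open>separated_subsets\<close>).
  The third is that a convergent series still converges after multiplication by a suitable \<open>G\<close> tending
  to infinity (\<open>summable_slow_multiplier\<close>): if a block with entries of size \<open>b\<close> is only seen at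
  distances where \<open>G\<close> exceeds \<open>b powr p\<close>, then one tail of a single convergent series controls all other
  blocks at once. The fourth is that the scalar field is separable, because the numbers \<open>W n * u n\<close>
  are dense in it for any frequently hypercyclic \<open>u\<close> (\<open>FHC_scalars_dense\<close>).
\<close>

section \<open>Sets of positive lower density\<close>

lemma lower_density_pos_iff:
  "lower_density E > 0 \<longleftrightarrow>
    (\<exists>d>0. \<exists>n0. \<forall>n\<ge>n0. d * real (n + 1) \<le> real (card (E \<inter> {0..n})))" (is "?L \<longleftrightarrow> ?R")
proof
  assume ?L
  then obtain d where d: "0 < ereal d" "ereal d < lower_density E"
    using ereal_dense2 by blast
  have "\<forall>\<^sub>F n in sequentially. ereal d < ereal (real (card (E \<inter> {0..n})) / real (n + 1))"
    using d(2) less_LiminfD unfolding lower_density_def by blast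
  then obtain n0 where "\<forall>n\<ge>n0. d < real (card (E \<inter> {0..n})) / real (n + 1)"
    by (auto simp: eventually_sequentially)
  then have "\<forall>n\<ge>n0. d * real (n + 1) \<le> real (card (E \<inter> {0..n}))"
    by (simp add: pos_less_divide_eq less_imp_le)
  then show ?R using d(1) by auto
next
  assume ?R
  then obtain d n0 where d: "d > 0" and *: "\<forall>n\<ge>n0. d * real (n + 1) \<le> real (card (E \<inter> {0..n}))"
    by blast
  have "ereal d \<le> lower_density E"
    unfolding lower_density_def
    by (rule Liminf_bounded)
      (use * in \<open>auto simp: eventually_sequentially pos_le_divide_eq intro!: exI[of _ n0]\<close>)
  then show ?L using d by (metis ereal_less(2) less_le_trans)
qed

lemma lower_density_pos_nonempty:
  assumes "lower_density E > 0"
  shows "E \<noteq> {}"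
proof
  assume "E = {}"
  then obtain d n0 where "0 < d" "\<forall>n\<ge>n0. d * real (n + 1) \<le> 0"
    using assms by (auto simp: lower_density_pos_iff)
  then have "d * real (n0 + 1) \<le> 0" "0 < d * real (n0 + 1)" by (blast, simp)
  then show False by linarith
qed

lemma lower_density_pos_mono:
  assumes "lower_density E > 0" "E \<subseteq> F"
  shows "lower_density F > 0"
proof -
  have "real (card (E \<inter> {0..n})) \<le> real (card (F \<inter> {0..n}))" for n
    using assms(2) by (intro of_nat_mono card_mono) auto
  then show ?thesis
    using assms(1) order_trans unfolding lower_density_pos_iff by (metis (no_types, lifting))
qed

text \<open>Keep every \<open>q\<close>-th element of \<open>F\<close> in increasing order. Consecutive kept elements are at least \<open>q\<close>
  apart, which also bounds the counting function above; leaving out the very first element of \<open>F\<close> makes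
  this bound \<open>n / q\<close> without an additive constant. The lower bound loses the factor \<open>q\<close> and an additive
  constant, absorbed by the further factor \<open>2\<close>.\<close>

lemma thin_subset:
  fixes F :: "nat set" and d :: real and q :: nat
  assumes d: "0 < d" and F: "\<forall>n\<ge>n0. d * real (n + 1) \<le> real (card (F \<inter> {0..n}))" and q: "1 \<le> q"
  obtains E n1 where "E \<subseteq> F" "\<And>n. n \<in> E \<Longrightarrow> q \<le> n"
    "\<And>m n. m \<in> E \<Longrightarrow> n \<in> E \<Longrightarrow> m < n \<Longrightarrow> m + q \<le> n"
    "\<And>n. card (E \<inter> {0..n}) * q \<le> n"
    "\<And>n. n1 \<le> n \<Longrightarrow> d / (2 * real q) * real (n + 1) \<le> real (card (E \<inter> {0..n}))"
proof -
  have inf: "infinite F"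
  proof
    assume fin: "finite F"
    obtain n :: nat where n: "real n > real (card F) / d" using reals_Archimedean2 by blast
    define N where "N = max n n0"
    have "real (card F) / d < real (N + 1)" using n by (simp add: N_def)
    then have "real (card F) < d * real (N + 1)" using d by (simp add: divide_less_eq mult.commute)
    also have "\<dots> \<le> real (card (F \<inter> {0..N}))" using F by (simp add: N_def)
    also have "\<dots> \<le> real (card F)" using fin by (simp add: card_mono)
    finally show False by simp
  qed
  define e where "e = enumerate F"
  have e_mono: "strict_mono e" unfolding e_def by (rule strict_mono_enumerate[OF inf])
  have e_in: "e i \<in> F" for i unfolding e_def by (rule enumerate_in_set[OF inf])
  have e_ge: "i \<le> e i" for i using strict_mono_imp_increasing[OF e_mono] .
  have e_gap: "e i + k \<le> e (i + k)" for i k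
  proof (induction k)
    case (Suc k)
    have "e (i + k) < e (Suc (i + k))" using e_mono by (simp add: strict_mono_def)
    then show ?case using Suc by simp
  qed simp
  define E where "E = (\<lambda>j. e (j * q)) ` {1..}"
  have inj: "inj (\<lambda>j. e (j * q))"
    using q strict_mono_eq[OF e_mono] by (auto intro!: injI)
  show ?thesis
  proof
    show "E \<subseteq> F" using e_in by (auto simp: E_def)
    show "q \<le> n" if n: "n \<in> E" for n
    proof -
      obtain j where j: "j \<ge> 1" "n = e (j * q)" using n by (auto simp: E_def)
      have "q \<le> j * q" using j by simp
      then show ?thesis using e_ge[of "j * q"] j by linarith
    qed
    show "m + q \<le> n" if "m \<in> E" "n \<in> E" "m < n" for m n
    proof -
      obtain i j where ij: "m = e (i * q)" "n = e (j * q)" using \<open>m \<in> E\<close> \<open>n \<in> E\<close> by (auto simp: E_def)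
      then have "i * q < j * q" using \<open>m < n\<close> strict_mono_less[OF e_mono] by simp
      then have "Suc i \<le> j" using q by simp
      then have "i * q + q \<le> j * q" using mult_le_mono1[of "Suc i" j q] by simp
      then have "e (i * q + q) \<le> e (j * q)" using strict_mono_less_eq[OF e_mono] by blast
      then show ?thesis using e_gap[of "i * q" q] ij by simp
    qed
    show "card (E \<inter> {0..n}) * q \<le> n" for n
    proof -
      have "E \<inter> {0..n} \<subseteq> (\<lambda>j. e (j * q)) ` {1..n div q}"
      proof
        fix x assume "x \<in> E \<inter> {0..n}"
        then obtain j where j: "j \<ge> 1" "x = e (j * q)" "x \<le> n" by (auto simp: E_def)
        have "j * q \<le> n" using e_ge[of "j * q"] j by simp
        then have "j \<le> n div q" using q by (simp add: less_eq_div_iff_mult_less_eq)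
        then show "x \<in> (\<lambda>j. e (j * q)) ` {1..n div q}" using j by auto
      qed
      then have "card (E \<inter> {0..n}) \<le> card {1..n div q}"
        by (rule surj_card_le[rotated]) simp
      then have "card (E \<inter> {0..n}) * q \<le> (n div q) * q" by simp
      also have "\<dots> \<le> n" by simp
      finally show ?thesis .
    qed
    define n1 where "n1 = max n0 (nat \<lceil>2 * real q / d\<rceil>)"
    show "d / (2 * real q) * real (n + 1) \<le> real (card (E \<inter> {0..n}))" if n: "n1 \<le> n" for n
    proof -
      define c where "c = card (F \<inter> {0..n})"
      have e_le: "e i \<le> n" if "i < c" for i
      proof (rule ccontr)
        assume "\<not> e i \<le> n"
        have "F \<inter> {0..n} \<subseteq> e ` {..<i}"
        proof
          fix x assume x: "x \<in> F \<inter> {0..n}"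
          then obtain j where j: "x = e j" unfolding e_def
            using enumerate_Ex[OF inf] by (metis IntD1)
          then have "e j < e i" using x \<open>\<not> e i \<le> n\<close> by simp
          then show "x \<in> e ` {..<i}" using j strict_mono_less[OF e_mono] by auto
        qed
        then have "c \<le> i" unfolding c_def using surj_card_le[of "{..<i}"] by simp
        then show False using that by simp
      qed
      have "(\<lambda>j. e (j * q)) ` {j. 1 \<le> j \<and> j * q < c} \<subseteq> E \<inter> {0..n}"
        using e_le by (auto simp: E_def)
      then have "card ((\<lambda>j. e (j * q)) ` {j. 1 \<le> j \<and> j * q < c}) \<le> card (E \<inter> {0..n})"
        by (intro card_mono) auto
      moreover have "{1..(c - 1) div q} \<subseteq> {j. 1 \<le> j \<and> j * q < c}"
      proof
        fix j assume j: "j \<in> {1..(c - 1) div q}"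
        then have "j * q \<le> c - 1" using q by (simp add: less_eq_div_iff_mult_less_eq)
        moreover have "1 \<le> j * q" using j q by simp
        ultimately have "j * q < c" by linarith
        then show "j \<in> {j. 1 \<le> j \<and> j * q < c}" using j by simp
      qed
      moreover have "finite {j. 1 \<le> j \<and> j * q < c}"
      proof (rule finite_subset)
        show "{j. 1 \<le> j \<and> j * q < c} \<subseteq> {..<c}"
        proof
          fix j assume j: "j \<in> {j. 1 \<le> j \<and> j * q < c}"
          have "j \<le> j * q" using q by simp
          then show "j \<in> {..<c}" using j unfolding mem_Collect_eq lessThan_iff by linarith
        qed
      qed simp
      ultimately have k: "(c - 1) div q \<le> card (E \<inter> {0..n})"
        using card_mono[of "{j. 1 \<le> j \<and> j * q < c}" "{1..(c - 1) div q}"]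
          card_image[OF inj_on_subset[OF inj, of "{j. 1 \<le> j \<and> j * q < c}"]] by simp
      have "c \<le> ((c - 1) div q + 1) * q"
      proof -
        have "(c - 1) mod q < q" using q by simp
        moreover have "c - 1 = (c - 1) div q * q + (c - 1) mod q" by simp
        ultimately have "c - 1 < (c - 1) div q * q + q" by linarith
        then show ?thesis by simp
      qed
      also have "\<dots> \<le> (card (E \<inter> {0..n}) + 1) * q" using k by simp
      finally have "real c \<le> (real (card (E \<inter> {0..n})) + 1) * real q"
        by (metis of_nat_1 of_nat_add of_nat_le_iff of_nat_mult)
      moreover have "d * real (n + 1) \<le> real c" using F n by (simp add: c_def n1_def)
      ultimately have 1: "d * real (n + 1) \<le> (real (card (E \<inter> {0..n})) + 1) * real q" by linarith
      have "2 * real q / d \<le> real (n + 1)" using n unfolding n1_def by linarith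
      then have 2: "2 * real q \<le> d * real (n + 1)" using d by (simp add: divide_le_eq mult.commute)
      have "d * real (n + 1) / (2 * real q) \<le> real (card (E \<inter> {0..n}))"
        using 1 2 q by (simp add: divide_le_eq algebra_simps)
      then show ?thesis by simp
    qed
  qed
qed

text \<open>First thin each \<open>F k\<close> to a set \<open>T k\<close> with gaps at least \<open>q k\<close>, where \<open>q\<close> grows very fast. Then delete
  from \<open>T k\<close> everything close to some \<open>T l\<close> with \<open>l > k\<close>. Each later set is so sparse compared
  with \<open>T k\<close> that all these deletions together remove at most half of the lower bound for \<open>T k\<close>.
  Deleting only in favour of later sets is what makes this work: \<open>q l\<close> can be chosen
  after the densities of all earlier sets are known.\<close>

lemma separated_subsets:
  fixes F :: "nat \<Rightarrow> nat set" and N :: "nat \<Rightarrow> nat"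
  assumes F: "\<And>k. lower_density (F k) > 0"
  obtains E where "\<And>k. E k \<subseteq> F k" "\<And>k. lower_density (E k) > 0" "\<And>k n. n \<in> E k \<Longrightarrow> N k \<le> n"
    "\<And>k l m n. m \<in> E k \<Longrightarrow> n \<in> E l \<Longrightarrow> m < n \<Longrightarrow> m + N k \<le> n \<and> m + N l \<le> n"
    "\<And>k l n. n \<in> E k \<Longrightarrow> n \<in> E l \<Longrightarrow> k = l"
proof -
  have "\<forall>k. \<exists>d n0. 0 < d \<and> (\<forall>n\<ge>n0. d * real (n + 1) \<le> real (card (F k \<inter> {0..n})))"
    using F unfolding lower_density_pos_iff by blast
  then obtain d n0 where d: "\<And>k. 0 < d k"
    and dF: "\<And>k. \<forall>n\<ge>n0 k. d k * real (n + 1) \<le> real (card (F k \<inter> {0..n}))" by metis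
  (* A monotone bound, so that the distance required between blocks k and l is M (max k l). *)
  define M where "M k = (\<Sum>i\<le>k. N i) + 1" for k
  have M_mono: "M k \<le> M l" if "k \<le> l" for k l
    unfolding M_def using that by (intro add_mono sum_mono2) auto
  have NM: "N k \<le> M k" for k
    unfolding M_def using member_le_sum[of k "{..k}" N] by simp
  define P where "P f l r \<longleftrightarrow> 2 * M l \<le> r \<and> l \<le> r \<and>
      (\<forall>k<l. real (M l) * (32 * 2 ^ l * real (f k)) \<le> d k * real r)"
    for f :: "nat \<Rightarrow> nat" and l r
  have "\<exists>q. \<forall>l. P q l (q l)"
  proof (rule dependent_wellorder_choice)
    show "P f x r = P g x r" if "\<And>y. y < x \<Longrightarrow> f y = g y" for f g x r
      using that by (simp add: P_def)
    show "\<exists>r. P f l r" for f l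
    proof -
      define X where "X k = nat \<lceil>real (M l) * (32 * 2 ^ l * real (f k)) / d k\<rceil>" for k
      define r where "r = 2 * M l + l + (\<Sum>k<l. X k)"
      have "real (M l) * (32 * 2 ^ l * real (f k)) \<le> d k * real r" if "k < l" for k
      proof -
        have "X k \<le> r" using that member_le_sum[of k "{..<l}" X] unfolding r_def by simp
        then have "real (M l) * (32 * 2 ^ l * real (f k)) / d k \<le> real r"
          unfolding X_def by linarith
        then show ?thesis using d[of k] by (simp add: divide_le_eq mult.commute)
      qed
      then have "P f l r" unfolding P_def r_def by simp
      then show ?thesis by blast
    qed
  qed
  then obtain q where q: "\<And>l. P q l (q l)" by blast
  have qM: "2 * M l \<le> q l" and ql: "l \<le> q l"
    and qd: "k < l \<Longrightarrow> real (M l) * (32 * 2 ^ l * real (q k)) \<le> d k * real (q l)" for k l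
    using q[of l] by (auto simp: P_def)
  have q1: "1 \<le> q l" for l using qM[of l] by (simp add: M_def)
  have "\<exists>E n1. E \<subseteq> F k \<and> (\<forall>n\<in>E. q k \<le> n) \<and> (\<forall>m\<in>E. \<forall>n\<in>E. m < n \<longrightarrow> m + q k \<le> n) \<and>
      (\<forall>n. card (E \<inter> {0..n}) * q k \<le> n) \<and>
      (\<forall>n\<ge>n1. d k / (2 * real (q k)) * real (n + 1) \<le> real (card (E \<inter> {0..n})))" for k
    by (rule thin_subset[OF d[of k] dF[of k] q1[of k]]) blast
  then obtain T n1 where TF: "\<And>k. T k \<subseteq> F k" and Tq: "\<And>k n. n \<in> T k \<Longrightarrow> q k \<le> n"
    and Tgap: "\<And>k m n. m \<in> T k \<Longrightarrow> n \<in> T k \<Longrightarrow> m < n \<Longrightarrow> m + q k \<le> n"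
    and Tup: "\<And>k n. card (T k \<inter> {0..n}) * q k \<le> n"
    and Tlow: "\<And>k n. n1 k \<le> n \<Longrightarrow> d k / (2 * real (q k)) * real (n + 1) \<le> real (card (T k \<inter> {0..n}))"
    by metis
  define E where "E k = {n \<in> T k. \<forall>l>k. \<forall>m\<in>T l. m + M l \<le> n \<or> n + M l \<le> m}" for k
  show ?thesis
  proof
    show "E k \<subseteq> F k" for k using TF by (auto simp: E_def)
    show "N k \<le> n" if "n \<in> E k" for k n
      using that Tq[of n k] qM[of k] NM[of k] by (auto simp: E_def)
    show "k = l" if "n \<in> E k" "n \<in> E l" for k l n
    proof -
      have "\<not> i < j" if "n \<in> E i" "n \<in> E j" for i j
      proof
        assume "i < j"
        then have "n + M j \<le> n \<or> n + M j \<le> n" using that unfolding E_def by blast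
        then show False by (simp add: M_def)
      qed
      then show ?thesis using that by (meson linorder_neqE_nat)
    qed
    show "m + N k \<le> n \<and> m + N l \<le> n" if m: "m \<in> E k" and n: "n \<in> E l" and less: "m < n" for k l m n
    proof -
      have "m + M (max k l) \<le> n"
      proof (cases k l rule: linorder_cases)
        case less
        then have "m + M l \<le> n \<or> n + M l \<le> m" using m n by (auto simp: E_def)
        then show ?thesis using \<open>m < n\<close> less by auto
      next
        case equal
        then show ?thesis using Tgap[of m k n] qM[of k] m n \<open>m < n\<close> by (auto simp: E_def)
      next
        case greater
        then have "m + M k \<le> n \<or> n + M k \<le> m" using m n by (auto simp: E_def)
        then show ?thesis using \<open>m < n\<close> greater by auto
      qed
      moreover have "N k \<le> M (max k l)" "N l \<le> M (max k l)"
        using NM M_mono by (meson le_trans max.cobounded1 max.cobounded2)+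
      ultimately show ?thesis by simp
    qed
    show "lower_density (E k) > 0" for k
      unfolding lower_density_pos_iff
    proof (intro exI conjI allI impI)
      show "0 < d k / (4 * real (q k))" using d[of k] q1[of k] by simp
      fix n assume n: "n1 k \<le> n"
      define R where "R = (\<Union>l\<in>{k<..2*n}. \<Union>m\<in>T l \<inter> {0..2*n}. {m - M l<..<m + M l})"
      have sub: "T k \<inter> {0..n} \<subseteq> (E k \<inter> {0..n}) \<union> R"
      proof
        fix x assume x: "x \<in> T k \<inter> {0..n}"
        show "x \<in> (E k \<inter> {0..n}) \<union> R"
        proof (cases "x \<in> E k")
          case False
          then obtain l m where lm: "l > k" "m \<in> T l" "x < m + M l" "m < x + M l"
            using x unfolding E_def by (auto simp: not_le)
          (* An element of T l is at least 2 * M l, so one that deletes some x \<le> n is at most 2 * n. *)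
          have "2 * M l \<le> m" using Tq[OF lm(2)] qM[of l] by simp
          then have "m \<le> 2 * n" using lm(4) x by simp
          moreover have "l \<le> m" using Tq[OF lm(2)] ql[of l] by simp
          moreover have "x \<in> {m - M l<..<m + M l}" using lm \<open>2 * M l \<le> m\<close> by auto
          ultimately show ?thesis unfolding R_def using lm
            by (intro UnI2 UN_I[of l] UN_I[of m]) auto
        qed (use x in auto)
      qed
      have "finite R" unfolding R_def by auto
      then have "card (T k \<inter> {0..n}) \<le> card ((E k \<inter> {0..n}) \<union> R)"
        by (intro card_mono[OF _ sub]) auto
      also have "\<dots> \<le> card (E k \<inter> {0..n}) + card R" by (rule card_Un_le)
      finally have 1: "real (card (T k \<inter> {0..n})) \<le> real (card (E k \<inter> {0..n})) + real (card R)"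
        by linarith
      have "card R \<le> (\<Sum>l\<in>{k<..2*n}. card (\<Union>m\<in>T l \<inter> {0..2*n}. {m - M l<..<m + M l}))"
        unfolding R_def by (rule card_UN_le) simp
      also have "\<dots> \<le> (\<Sum>l\<in>{k<..2*n}. card (T l \<inter> {0..2*n}) * (2 * M l))"
      proof (rule sum_mono)
        fix l
        have "card (\<Union>m\<in>T l \<inter> {0..2*n}. {m - M l<..<m + M l})
            \<le> (\<Sum>m\<in>T l \<inter> {0..2*n}. card {m - M l<..<m + M l})"
          by (rule card_UN_le) simp
        also have "\<dots> \<le> (\<Sum>m\<in>T l \<inter> {0..2*n}. 2 * M l)"
          by (rule sum_mono) auto
        finally show "card (\<Union>m\<in>T l \<inter> {0..2*n}. {m - M l<..<m + M l})
            \<le> card (T l \<inter> {0..2*n}) * (2 * M l)" by simp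
      qed
      finally have "real (card R) \<le> (\<Sum>l\<in>{k<..2*n}. real (card (T l \<inter> {0..2*n}) * (2 * M l)))"
        by (simp only: of_nat_le_iff flip: of_nat_sum)
      also have "\<dots> \<le> (\<Sum>l\<in>{k<..2*n}. d k / (8 * real (q k)) * real (n + 1) * (1 / 2) ^ l)"
      proof (rule sum_mono)
        fix l assume l: "l \<in> {k<..2*n}"
        have "real (card (T l \<inter> {0..2*n})) * real (q l) \<le> 2 * real n"
          using Tup[of l "2 * n"] by (metis of_nat_le_iff of_nat_mult of_nat_numeral)
        then have a: "real (card (T l \<inter> {0..2*n})) \<le> 2 * real (n + 1) / real (q l)"
          using q1[of l] by (simp add: le_divide_eq)
        have "real (M l) \<le> d k * real (q l) / (32 * 2 ^ l * real (q k))"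
          using qd[of k l] l q1[of k] by (simp add: le_divide_eq)
        with a have "real (card (T l \<inter> {0..2*n})) * real (M l) \<le>
            2 * real (n + 1) / real (q l) * (d k * real (q l) / (32 * 2 ^ l * real (q k)))"
          by (intro mult_mono) auto
        also have "\<dots> = d k / (16 * real (q k)) * real (n + 1) * (1 / 2) ^ l"
          using q1[of l] q1[of k] by (simp add: power_divide field_simps)
        finally show "real (card (T l \<inter> {0..2*n}) * (2 * M l))
            \<le> d k / (8 * real (q k)) * real (n + 1) * (1 / 2) ^ l" by simp
      qed
      also have "\<dots> = d k / (8 * real (q k)) * real (n + 1) * (\<Sum>l\<in>{k<..2*n}. (1 / 2) ^ l)"
        by (simp add: sum_distrib_left)
      also have "\<dots> \<le> d k / (8 * real (q k)) * real (n + 1) * 2"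
      proof (rule mult_left_mono)
        have "(\<Sum>l\<in>{k<..2*n}. (1 / 2) ^ l) \<le> (\<Sum>l. (1 / 2 :: real) ^ l)"
          by (rule sum_le_suminf) (auto simp: summable_geometric)
        then show "(\<Sum>l\<in>{k<..2*n}. (1 / 2 :: real) ^ l) \<le> 2" by (simp add: suminf_geometric)
      qed (use d[of k] in auto)
      finally have 2: "real (card R) \<le> d k / (4 * real (q k)) * real (n + 1)" by simp
      have "d k / (2 * real (q k)) * real (n + 1) = 2 * (d k / (4 * real (q k)) * real (n + 1))"
        by simp
      then show "d k / (4 * real (q k)) * real (n + 1) \<le> real (card (E k \<inter> {0..n}))"
        using 1 2 Tlow[OF n] by linarith
    qed
  qed
qed

section \<open>Two facts on series\<close>

text \<open>Averaging the bound over \<open>m \<in> E\<close> controls \<open>v j\<close> for those \<open>j\<close> for which \<open>E\<close> and its translate by \<open>j\<close>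
  overlap in positive density. Such \<open>j\<close> occur with bounded gaps: take finitely many translates
  of \<open>E\<close> whose union is as dense as possible, up to a fixed amount \<open>\<gamma>\<close>; every further translate must
  then overlap one of them. Since \<open>v n \<le> C ^ i * v (n + i)\<close>, control with bounded gaps is enough.
  Densities are measured along an infinite set \<open>T\<close> of lengths that shrinks while
  translates are added, because a failure to overlap is only seen along a subsequence.\<close>

lemma summable_if_bounded_return_sums:
  fixes v :: "nat \<Rightarrow> real" and E :: "nat set"
  assumes E: "lower_density E > 0" and v: "\<And>n. 0 \<le> v n"
    and C: "1 \<le> C" and step: "\<And>n. v n \<le> C * v (Suc n)"
    and ret: "\<And>m J. m \<in> E \<Longrightarrow> (\<Sum>j | j < J \<and> m + j \<in> E. v j) \<le> B"
  shows "summable v"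
proof -
  obtain \<beta> n0 where \<beta>: "0 < \<beta>" and low: "\<And>n. n0 \<le> n \<Longrightarrow> \<beta> * real (n + 1) \<le> real (card (E \<inter> {0..n}))"
    using E unfolding lower_density_pos_iff by blast
  have "0 < \<beta> * real (n0 + 1)" using \<beta> by simp
  then have E_ne: "E \<noteq> {}" using low[of n0] by auto
  then have B: "0 \<le> B" using ret[of _ 0] by auto
  define U where "U S = (\<Union>s\<in>S. (+) s ` E)" for S
  define \<gamma> where "\<gamma> = \<beta> / 4"
  have \<gamma>: "0 < \<gamma>" using \<beta> by (simp add: \<gamma>_def)
  have shift: "2 * \<gamma> * real (N + 1) \<le> real (card ((+) n ` E \<inter> {0..N}))" if N: "2 * n + n0 \<le> N" for n N
  proof -
    have "(+) n ` E \<inter> {0..N} = (+) n ` (E \<inter> {0..N - n})" using N by auto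
    then have "card ((+) n ` E \<inter> {0..N}) = card (E \<inter> {0..N - n})" by (simp add: card_image)
    moreover have "\<beta> * real (N - n + 1) \<le> real (card (E \<inter> {0..N - n}))" using N by (intro low) simp
    moreover have "\<beta> * (real (N + 1) / 2) \<le> \<beta> * real (N - n + 1)"
      using N \<beta> by (intro mult_left_mono) (simp_all add: of_nat_diff)
    moreover have "2 * \<gamma> * real (N + 1) = \<beta> * (real (N + 1) / 2)" by (simp add: \<gamma>_def)
    ultimately show ?thesis by linarith
  qed
  (* P r: some finite union of translates has density at least r * \<gamma> along infinitely many lengths. *)
  define P where "P r \<longleftrightarrow> (\<exists>S T. finite S \<and> infinite T \<and>
      (\<forall>N\<in>T. real r * \<gamma> * real (N + 1) \<le> real (card (U S \<inter> {0..N}))))" for r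
  have "P 0"
    unfolding P_def
  proof (intro exI conjI)
    show "finite ({} :: nat set)" "infinite (UNIV :: nat set)" by simp_all
  qed simp
  moreover have "r \<le> nat \<lceil>1 / \<gamma>\<rceil>" if "P r" for r
  proof -
    from that obtain S T where ST: "finite S \<and> infinite T \<and>
        (\<forall>N\<in>T. real r * \<gamma> * real (N + 1) \<le> real (card (U S \<inter> {0..N})))"
      unfolding P_def by (elim exE)
    then have "T \<noteq> {}" by auto
    then obtain N where "N \<in> T" by fast
    then have "real r * \<gamma> * real (N + 1) \<le> real (card (U S \<inter> {0..N}))" using ST by blast
    also have "\<dots> \<le> 1 * real (N + 1)" using card_mono[of "{0..N}" "U S \<inter> {0..N}"] by simp
    finally have "real r * \<gamma> \<le> 1" by (subst (asm) mult_le_cancel_right) auto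
    then have "real r \<le> 1 / \<gamma>" using \<gamma> by (simp add: le_divide_eq)
    then show ?thesis by linarith
  qed
  ultimately obtain r where r: "P r" and r_max: "\<And>y. P y \<Longrightarrow> y \<le> r"
    using Nat.ex_has_greatest_nat[of P 0 "nat \<lceil>1 / \<gamma>\<rceil>"] by blast
  obtain S T where S: "finite S" and T: "infinite T"
    and ST: "\<And>N. N \<in> T \<Longrightarrow> real r * \<gamma> * real (N + 1) \<le> real (card (U S \<inter> {0..N}))"
    using r unfolding P_def by blast
  (* Lengths along which the translate by n overlaps the union too little; were there infinitely
     many of them, adding the translate by n would gain another \<gamma>. *)
  define Bad where "Bad n = {N \<in> T. real (card ((+) n ` E \<inter> U S \<inter> {0..N})) < \<gamma> * real (N + 1)}" for n
  have fin_bad: "finite (Bad n)" for n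
  proof (rule ccontr)
    assume inf: "infinite (Bad n)"
    define T' where "T' = Bad n - {..<2 * n + n0}"
    have "infinite T'" unfolding T'_def using inf by simp
    moreover have "real (Suc r) * \<gamma> * real (N + 1) \<le> real (card (U (insert n S) \<inter> {0..N}))"
      if N: "N \<in> T'" for N
    proof -
      have "U (insert n S) \<inter> {0..N} = ((+) n ` E \<inter> {0..N}) \<union> (U S \<inter> {0..N})"
        by (auto simp: U_def)
      moreover have "card ((+) n ` E \<inter> {0..N}) + card (U S \<inter> {0..N}) =
          card (((+) n ` E \<inter> {0..N}) \<union> (U S \<inter> {0..N})) + card (((+) n ` E \<inter> {0..N}) \<inter> (U S \<inter> {0..N}))"
        by (rule card_Un_Int) auto
      moreover have "((+) n ` E \<inter> {0..N}) \<inter> (U S \<inter> {0..N}) = (+) n ` E \<inter> U S \<inter> {0..N}" by auto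
      ultimately have "real (card ((+) n ` E \<inter> {0..N})) + real (card (U S \<inter> {0..N})) =
          real (card (U (insert n S) \<inter> {0..N})) + real (card ((+) n ` E \<inter> U S \<inter> {0..N}))"
        by (metis of_nat_add)
      moreover have "real (card ((+) n ` E \<inter> U S \<inter> {0..N})) < \<gamma> * real (N + 1)"
        using N by (simp add: T'_def Bad_def)
      moreover have "2 * \<gamma> * real (N + 1) \<le> real (card ((+) n ` E \<inter> {0..N}))"
        using N by (intro shift) (simp add: T'_def)
      moreover have "real r * \<gamma> * real (N + 1) \<le> real (card (U S \<inter> {0..N}))"
        using N by (intro ST) (simp add: T'_def Bad_def)
      moreover have "real (Suc r) * \<gamma> * real (N + 1) =
          real r * \<gamma> * real (N + 1) + 2 * \<gamma> * real (N + 1) - \<gamma> * real (N + 1)"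
        by (simp add: algebra_simps)
      ultimately show ?thesis by linarith
    qed
    ultimately have "P (Suc r)" unfolding P_def using S by (intro exI[of _ "insert n S"] exI[of _ T']) auto
    then show False using r_max[of "Suc r"] by simp
  qed
  obtain K where K: "\<And>s. s \<in> S \<Longrightarrow> s \<le> K" using S finite_nat_set_iff_bounded_le by metis
  have steps: "v n \<le> C ^ i * v (n + i)" for n i
  proof (induction i)
    case (Suc i)
    have "C ^ i * v (n + i) \<le> C ^ i * (C * v (Suc (n + i)))"
      using C by (intro mult_left_mono step) auto
    then show ?case using Suc by (simp add: mult.assoc mult.left_commute)
  qed simp
  (* The index n is compared with the differences n + K - s \<ge> n, because v can only be bounded by
     its later values. *)
  have bound: "(\<Sum>n<J. v n) \<le> C ^ K * real (card S) * B / \<gamma>" for J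
  proof -
    have "infinite (T - (\<Union>n<J. Bad (n + K)))" using T fin_bad by (simp add: Diff_infinite_finite)
    then have "T - (\<Union>n<J. Bad (n + K)) \<noteq> {}" by (metis finite.emptyI)
    then obtain N where N: "N \<in> T" "\<And>n. n < J \<Longrightarrow> N \<notin> Bad (n + K)" by blast
    define D where "D = E \<inter> {0..N}"
    have fin: "finite D" by (simp add: D_def)
    have count: "\<gamma> * real (N + 1) \<le> (\<Sum>s\<in>S. real (card {m \<in> D. m + (n + K - s) \<in> E}))" if n: "n < J" for n
    proof -
      have "(+) (n + K) ` E \<inter> U S \<inter> {0..N} \<subseteq> (+) (n + K) ` (\<Union>s\<in>S. {m \<in> D. m + (n + K - s) \<in> E})"
      proof
        fix x assume x: "x \<in> (+) (n + K) ` E \<inter> U S \<inter> {0..N}"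
        then obtain m where m: "x = n + K + m" "m \<in> E" by auto
        obtain s m' where s: "s \<in> S" "x = s + m'" "m' \<in> E" using x by (auto simp: U_def)
        have "m' = m + (n + K - s)" using K[OF s(1)] m s by simp
        moreover have "m \<in> D" using m x by (simp add: D_def)
        ultimately show "x \<in> (+) (n + K) ` (\<Union>s\<in>S. {m \<in> D. m + (n + K - s) \<in> E})"
          using s m by blast
      qed
      then have "card ((+) (n + K) ` E \<inter> U S \<inter> {0..N}) \<le> card (\<Union>s\<in>S. {m \<in> D. m + (n + K - s) \<in> E})"
        using S fin by (intro surj_card_le) auto
      also have "\<dots> \<le> (\<Sum>s\<in>S. card {m \<in> D. m + (n + K - s) \<in> E})" by (rule card_UN_le[OF S])
      finally have "real (card ((+) (n + K) ` E \<inter> U S \<inter> {0..N}))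
          \<le> (\<Sum>s\<in>S. real (card {m \<in> D. m + (n + K - s) \<in> E}))"
        by (simp only: of_nat_le_iff flip: of_nat_sum)
      moreover have "\<gamma> * real (N + 1) \<le> real (card ((+) (n + K) ` E \<inter> U S \<inter> {0..N}))"
        using N(1) N(2)[OF n] unfolding Bad_def mem_Collect_eq by linarith
      ultimately show ?thesis by linarith
    qed
    have "(\<Sum>n<J. v n) * (\<gamma> * real (N + 1))
        \<le> (\<Sum>n<J. v n * (\<Sum>s\<in>S. real (card {m \<in> D. m + (n + K - s) \<in> E})))"
      unfolding sum_distrib_right by (intro sum_mono mult_left_mono count v) simp
    also have "\<dots> = (\<Sum>n<J. \<Sum>s\<in>S. \<Sum>m\<in>D. if m + (n + K - s) \<in> E then v n else 0)"
      using fin by (simp add: sum_distrib_left sum.inter_filter[symmetric] mult.commute)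
    also have "\<dots> \<le> (\<Sum>n<J. \<Sum>s\<in>S. \<Sum>m\<in>D.
        if m + (n + K - s) \<in> E then C ^ K * v (n + K - s) else 0)"
    proof (intro sum_mono)
      fix n s m assume s: "s \<in> S"
      have "v n \<le> C ^ (K - s) * v (n + (K - s))" by (rule steps)
      also have "\<dots> \<le> C ^ K * v (n + (K - s))"
        using C v by (intro mult_right_mono power_increasing) auto
      finally show "(if m + (n + K - s) \<in> E then v n else 0)
          \<le> (if m + (n + K - s) \<in> E then C ^ K * v (n + K - s) else 0)"
        using K[OF s] by simp
    qed
    also have "\<dots> = (\<Sum>s\<in>S. \<Sum>m\<in>D. \<Sum>n<J. if m + (n + K - s) \<in> E then C ^ K * v (n + K - s) else 0)"
      by (subst sum.swap, rule sum.cong[OF refl], rule sum.swap)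
    also have "\<dots> \<le> (\<Sum>s\<in>S. \<Sum>m\<in>D. C ^ K * B)"
    proof (intro sum_mono)
      fix s m assume s: "s \<in> S" and m: "m \<in> D"
      have "(\<Sum>n<J. if m + (n + K - s) \<in> E then C ^ K * v (n + K - s) else 0) =
          C ^ K * (\<Sum>n<J. if m + (n + (K - s)) \<in> E then v (n + (K - s)) else 0)"
        using K[OF s] by (auto simp: sum_distrib_left intro!: sum.cong)
      also have "(\<Sum>n<J. if m + (n + (K - s)) \<in> E then v (n + (K - s)) else 0) =
          (\<Sum>j\<in>(\<lambda>n. n + (K - s)) ` {..<J}. if m + j \<in> E then v j else 0)"
        by (subst sum.reindex) auto
      also have "\<dots> \<le> (\<Sum>j<J + K. if m + j \<in> E then v j else 0)"
        using v by (intro sum_mono2) auto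
      also have "\<dots> = (\<Sum>j | j < J + K \<and> m + j \<in> E. v j)"
        by (subst sum.inter_filter[symmetric]) auto
      also have "\<dots> \<le> B" using m by (intro ret) (simp add: D_def)
      finally show "(\<Sum>n<J. if m + (n + K - s) \<in> E then C ^ K * v (n + K - s) else 0) \<le> C ^ K * B"
        using C by (simp add: mult_left_mono)
    qed
    also have "\<dots> = real (card S) * (C ^ K * B) * real (card D)" by simp
    also have "\<dots> \<le> real (card S) * (C ^ K * B) * real (N + 1)"
      using card_mono[of "{0..N}" D] B C by (intro mult_left_mono) (auto simp: D_def)
    finally have "((\<Sum>n<J. v n) * \<gamma>) * real (N + 1) \<le> (C ^ K * real (card S) * B) * real (N + 1)"
      by (simp add: mult_ac)
    then have "(\<Sum>n<J. v n) * \<gamma> \<le> C ^ K * real (card S) * B"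
      by (subst (asm) mult_le_cancel_right) auto
    then show ?thesis using \<gamma> by (simp add: le_divide_eq)
  qed
  show ?thesis by (rule summableI_nonneg_bounded[OF v bound])
qed

text \<open>This is the theorem of du Bois-Reymond, with \<open>G n\<close> the inverse square root of the tail \<open>t n\<close> of the
  series: from \<open>v n = t n - t (n + 1)\<close> one gets \<open>v n / sqrt (t n) \<le> 2 * (sqrt (t n) - sqrt (t (n + 1)))\<close>,
  and the right-hand side telescopes.\<close>

lemma summable_slow_multiplier:
  fixes v :: "nat \<Rightarrow> real"
  assumes v: "\<And>n. 0 < v n" and s: "summable v"
  obtains G where "filterlim G at_top sequentially" "\<And>n. 0 < G n" "summable (\<lambda>n. G n * v n)"
proof
  define t where "t n = (\<Sum>i. v (i + n))" for n
  have st: "summable (\<lambda>i. v (i + n))" for n using s by (simp add: summable_iff_shift)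
  have t_pos: "0 < t n" for n unfolding t_def by (rule suminf_pos[OF st v])
  have t_Suc: "t n = v n + t (Suc n)" for n
    using suminf_split_head[OF st[of n]] by (simp add: t_def)
  have t_lim: "t \<longlonglongrightarrow> 0" unfolding t_def by (rule suminf_exist_split2[OF s])
  have sq_lim: "(\<lambda>n. sqrt (t n)) \<longlonglongrightarrow> 0" using tendsto_real_sqrt[OF t_lim] by simp
  define G where "G n = inverse (sqrt (t n))" for n
  show "0 < G n" for n using t_pos by (simp add: G_def)
  show "filterlim G at_top sequentially"
    unfolding G_def by (rule filterlim_inverse_at_top[OF sq_lim]) (simp add: t_pos)
  show "summable (\<lambda>n. G n * v n)"
  proof (rule summable_comparison_test')
    show "summable (\<lambda>n. 2 * (sqrt (t n) - sqrt (t (Suc n))))"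
      using telescope_summable'[OF sq_lim] by (rule summable_mult)
    fix n :: nat
    define a b where "a = sqrt (t n)" and "b = sqrt (t (Suc n))"
    have ab: "0 < a" "0 \<le> b" "b \<le> a" "v n = a ^ 2 - b ^ 2"
      using t_pos[of n] t_pos[of "Suc n"] t_Suc[of n] v[of n] by (auto simp: a_def b_def)
    have "v n = (a - b) * (a + b)" using ab(4) by (simp add: power2_eq_square algebra_simps)
    also have "\<dots> \<le> (a - b) * (2 * a)" using ab by (intro mult_left_mono) auto
    finally have "inverse a * v n \<le> 2 * (a - b)" using ab(1) by (simp add: field_simps)
    then show "norm (G n * v n) \<le> 2 * (sqrt (t n) - sqrt (t (Suc n)))"
      using v[of n] t_pos[of n] by (simp add: G_def a_def b_def)
  qed
qed

section \<open>The sequence spaces and their weighted shifts\<close>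

lemma lp_coord_le:
  assumes p: "1 \<le> p" and x: "x \<in> lp p"
  shows "norm (x n) \<le> lp_norm p x"
proof -
  have s: "summable (\<lambda>n. norm (x n) powr p)" using x by (simp add: lp_def)
  have "norm (x n) powr p = (\<Sum>i\<in>{n}. norm (x i) powr p)" by simp
  also have "\<dots> \<le> (\<Sum>i. norm (x i) powr p)" by (rule sum_le_suminf[OF s]) auto
  finally have "(norm (x n) powr p) powr (1 / p) \<le> lp_norm p x"
    unfolding lp_norm_def using p by (intro powr_mono2) auto
  then show ?thesis using p by (simp add: powr_powr)
qed

lemma lp_norm_lessI:
  assumes p: "1 \<le> p" and r: "0 < r" and x: "x \<in> lp p" and less: "(\<Sum>n. norm (x n) powr p) < r powr p"
  shows "lp_norm p x < r"
proof -
  have "0 \<le> (\<Sum>n. norm (x n) powr p)" using x by (auto simp: lp_def intro!: suminf_nonneg)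
  then have "lp_norm p x < (r powr p) powr (1 / p)"
    unfolding lp_norm_def using p less by (intro powr_less_mono2) auto
  then show ?thesis using p r by (simp add: powr_powr)
qed

lemma finite_support_in_lp:
  assumes "\<And>n. L \<le> n \<Longrightarrow> x n = 0"
  shows "x \<in> lp p"
  unfolding lp_def mem_Collect_eq
  by (rule summable_finite[of "{..<L}"]) (use assms in \<open>auto simp: not_less\<close>)

lemma openin_lp_ball:
  assumes p: "1 \<le> p" and x: "x \<in> lp p"
  shows "openin (lp_topology p) {y \<in> lp p. lp_dist p x y < r}"
proof -
  interpret Metric_space "lp p" "lp_dist p" by (rule Metric_space_lp[OF p])
  have "{y \<in> lp p. lp_dist p x y < r} = mball x r" using x by auto
  then show ?thesis unfolding lp_topology_def by simp
qed

lemma openin_lp_contains_ball: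
  assumes p: "1 \<le> p" and U: "openin (lp_topology p) U" and x: "x \<in> U"
  obtains r where "0 < r" "\<And>y. y \<in> lp p \<Longrightarrow> lp_dist p x y < r \<Longrightarrow> y \<in> U" "x \<in> lp p"
proof -
  interpret Metric_space "lp p" "lp_dist p" by (rule Metric_space_lp[OF p])
  have "U \<subseteq> lp p" "\<exists>r>0. mball x r \<subseteq> U" using U x unfolding lp_topology_def openin_mtopology by auto
  then obtain r where "x \<in> lp p" "0 < r" "mball x r \<subseteq> U" using x by auto
  then show ?thesis by (intro that[of r]) auto
qed

definition wprod :: "(nat \<Rightarrow> real) \<Rightarrow> nat \<Rightarrow> real" where
  "wprod w n = (\<Prod>k=1..n. w k)"

lemma wprod_0 [simp]: "wprod w 0 = 1"
  by (simp add: wprod_def)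

lemma wprod_Suc: "wprod w (Suc n) = wprod w n * w (Suc n)"
  by (simp add: wprod_def)

lemma wprod_pos: "\<forall>k\<ge>1. w k > 0 \<Longrightarrow> 0 < wprod w n"
  by (auto simp: wprod_def intro: prod_pos)

lemma weighted_shift_apply: "weighted_shift w x j = w (Suc j) *\<^sub>R x (Suc j)"
  by (simp add: weighted_shift_def)

lemma weighted_shift_funpow:
  assumes w: "\<forall>k\<ge>1. w k > 0"
  shows "(weighted_shift w ^^ n) x = (\<lambda>j. (wprod w (n + j) / wprod w j) *\<^sub>R x (n + j))"
proof (induction n)
  case 0
  then show ?case using wprod_pos[OF w] by (simp add: order_less_imp_not_eq2)
next
  case (Suc n)
  show ?case
  proof
    fix j
    have "w (Suc j) * (wprod w (n + Suc j) / wprod w (Suc j)) = wprod w (Suc n + j) / wprod w j"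
      using w[rule_format, of "Suc j"] wprod_pos[OF w, of j] by (simp add: wprod_Suc)
    moreover have "(weighted_shift w ^^ Suc n) x j = w (Suc j) *\<^sub>R (weighted_shift w ^^ n) x (Suc j)"
      by (simp add: weighted_shift_apply)
    ultimately show "(weighted_shift w ^^ Suc n) x j
        = (wprod w (Suc n + j) / wprod w j) *\<^sub>R x (Suc n + j)"
      unfolding Suc by simp
  qed
qed

lemma bounded_shift_weights_bounded:
  assumes p: "1 \<le> p" and bd: "lp_bounded p (weighted_shift w :: (nat \<Rightarrow> 'a::real_normed_field) \<Rightarrow> nat \<Rightarrow> 'a)"
  obtains C where "1 \<le> C" "\<And>n. w (Suc n) \<le> C"
proof -
  obtain C where maps: "weighted_shift w ` lp p \<subseteq> (lp p :: (nat \<Rightarrow> 'a) set)"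
    and C: "\<And>x :: nat \<Rightarrow> 'a. x \<in> lp p \<Longrightarrow> lp_norm p (weighted_shift w x) \<le> C * lp_norm p x"
    using bd unfolding lp_bounded_def by blast
  have "w (Suc n) \<le> max 1 C" for n
  proof -
    define e :: "nat \<Rightarrow> 'a" where "e = (\<lambda>m. if m = Suc n then 1 else 0)"
    have e: "e \<in> lp p" by (rule finite_support_in_lp[of "n + 2"]) (simp add: e_def)
    have "(\<lambda>m. norm (e m) powr p) = (\<lambda>m. if m = Suc n then 1 else 0)" using p by (auto simp: e_def)
    then have "lp_norm p e = 1" using sums_single[of "Suc n" "\<lambda>_. 1 :: real"]
      by (simp add: lp_norm_def sums_iff)
    then have "lp_norm p (weighted_shift w e) \<le> C" using C[OF e] by simp
    moreover have "norm (weighted_shift w e n) \<le> lp_norm p (weighted_shift w e)"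
      using maps e by (intro lp_coord_le[OF p]) auto
    ultimately show ?thesis by (simp add: weighted_shift_def e_def)
  qed
  then show ?thesis by (intro that[of "max 1 C"]) auto
qed

lemma notin_HC_if_coordinate_avoids:
  fixes x :: "nat \<Rightarrow> 'a::real_normed_field"
  assumes p: "1 \<le> p" and \<delta>: "0 < \<delta>" and far: "\<And>n. \<delta> \<le> norm ((T ^^ n) x 0 - z)"
  shows "x \<notin> HC p T"
proof
  assume x: "x \<in> HC p T"
  define b where "b = (\<lambda>n::nat. if n = 0 then z else 0)"
  have b: "b \<in> lp p" by (rule finite_support_in_lp[of 1]) (simp add: b_def)
  have "lp_dist p b b = 0" using Metric_space.mdist_zero[OF Metric_space_lp[OF p] b] .
  then have "b \<in> {y \<in> lp p. lp_dist p b y < \<delta>}" using b \<delta> by simp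
  moreover have "b \<in> lp_topology p closure_of {(T ^^ n) x | n. True}" using x b by (simp add: HC_def)
  ultimately have "\<exists>y. y \<in> {(T ^^ n) x | n. True} \<and> y \<in> {y \<in> lp p. lp_dist p b y < \<delta>}"
    using openin_lp_ball[OF p b, of \<delta>] unfolding in_closure_of by meson
  then obtain n where n: "(T ^^ n) x \<in> lp p" "lp_dist p b ((T ^^ n) x) < \<delta>" by fast
  have "norm (b 0 - (T ^^ n) x 0) \<le> lp_dist p b ((T ^^ n) x)"
    unfolding lp_dist_def by (rule lp_coord_le[OF p, of "\<lambda>i. b i - (T ^^ n) x i"]) (rule lp_diff[OF p b n(1)])
  then show False using n(2) far[of n] by (simp add: b_def norm_minus_commute)
qed

section \<open>Consequences of frequent hypercyclicity\<close>

text \<open>The orbit meets every ball around a sequence of the form \<open>(z, 0, 0, ...)\<close>, and coordinate \<open>0\<close> of the \<open>n\<close>-th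
  iterate of \<open>u\<close> is \<open>wprod w n *\<^sub>R u n\<close>.\<close>

lemma FHC_scalars_dense:
  fixes u :: "nat \<Rightarrow> 'a::real_normed_field"
  assumes p: "1 \<le> p" and w: "\<forall>k\<ge>1. w k > 0" and u: "u \<in> FHC p (weighted_shift w)" and \<epsilon>: "0 < \<epsilon>"
  shows "\<exists>n. norm (wprod w n *\<^sub>R u n - z) < \<epsilon>"
proof -
  define b where "b = (\<lambda>n::nat. if n = 0 then z else 0)"
  have b: "b \<in> lp p" by (rule finite_support_in_lp[of 1]) (simp add: b_def)
  define U where "U = {y \<in> lp p. lp_dist p b y < \<epsilon>}"
  have "lp_dist p b b = 0" using Metric_space.mdist_zero[OF Metric_space_lp[OF p] b] .
  then have "b \<in> U" using b \<epsilon> by (simp add: U_def)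
  then have "lower_density {k. (weighted_shift w ^^ k) u \<in> U} > 0"
    using u openin_lp_ball[OF p b] unfolding FHC_def U_def by blast
  then have "{k. (weighted_shift w ^^ k) u \<in> U} \<noteq> {}" by (rule lower_density_pos_nonempty)
  then obtain n where n: "(weighted_shift w ^^ n) u \<in> U" by blast
  then have "norm (b 0 - (weighted_shift w ^^ n) u 0) \<le> lp_dist p b ((weighted_shift w ^^ n) u)"
    unfolding lp_dist_def by (intro lp_coord_le[OF p, of "\<lambda>i. b i - (weighted_shift w ^^ n) u i"] lp_diff[OF p b])
      (simp add: U_def)
  also have "\<dots> < \<epsilon>" using n by (simp add: U_def)
  finally have "norm (wprod w n *\<^sub>R u n - z) < \<epsilon>"
    by (simp add: b_def weighted_shift_funpow[OF w] norm_minus_commute)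
  then show ?thesis by blast
qed

text \<open>Let \<open>E\<close> be the set of times at which the orbit is within \<open>1 / 2\<close> of the unit vector \<open>e\<^sub>0\<close>. At times \<open>n \<in> E\<close>
  coordinate \<open>0\<close> gives \<open>norm (u n) \<ge> 1 / (2 * W n)\<close>. Seen from an earlier time \<open>m \<in> E\<close>, the same entry
  \<open>u (m + j)\<close> is coordinate \<open>j\<close> of the iterate and has size at least \<open>1 / (2 * W j)\<close>. As the iterate is close to \<open>e\<^sub>0\<close>,
  the sum of \<open>1 / W j powr p\<close> over the return times \<open>j\<close> from \<open>m\<close> is bounded independently of \<open>m\<close>.\<close>

lemma FHC_shift_imp_summable:
  fixes u :: "nat \<Rightarrow> 'a::real_normed_field"
  assumes p: "1 \<le> p" and w: "\<forall>k\<ge>1. w k > 0"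
    and bd: "lp_bounded p (weighted_shift w :: (nat \<Rightarrow> 'a) \<Rightarrow> nat \<Rightarrow> 'a)"
    and u: "u \<in> FHC p (weighted_shift w)"
  shows "summable (\<lambda>n. (1 / wprod w n) powr p)"
proof -
  define W where "W = wprod w"
  have W: "0 < W n" for n using wprod_pos[OF w] by (simp add: W_def)
  obtain C where C: "1 \<le> C" "\<And>n. w (Suc n) \<le> C" using bounded_shift_weights_bounded[OF p bd] by blast
  define b :: "nat \<Rightarrow> 'a" where "b = (\<lambda>n. if n = 0 then 1 else 0)"
  have b: "b \<in> lp p" by (rule finite_support_in_lp[of 1]) (simp add: b_def)
  define U where "U = {y \<in> lp p. lp_dist p b y < 1 / 2}"
  define E where "E = {n. (weighted_shift w ^^ n) u \<in> U}"
  have "lp_dist p b b = 0" using Metric_space.mdist_zero[OF Metric_space_lp[OF p] b] .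
  then have "b \<in> U" using b by (simp add: U_def)
  then have dens: "lower_density E > 0"
    using u openin_lp_ball[OF p b, of "1 / 2"] unfolding FHC_def E_def U_def by blast
  define D where "D m j = b j - (weighted_shift w ^^ m) u j" for m j
  have D: "D m \<in> lp p" "lp_norm p (D m) < 1 / 2" if "m \<in> E" for m
    using that lp_diff[OF p b, of "(weighted_shift w ^^ m) u"]
    by (simp_all add: E_def U_def D_def[abs_def] lp_dist_def)
  have big: "1 / 2 \<le> W n * norm (u n)" if "n \<in> E" for n
  proof -
    have "norm (1 - W n *\<^sub>R u n) < 1 / 2"
      using lp_coord_le[OF p D(1)[OF that], of 0] D(2)[OF that]
      by (simp add: D_def b_def weighted_shift_funpow[OF w] W_def)
    moreover have "norm (1 :: 'a) - norm (W n *\<^sub>R u n) \<le> norm (1 - W n *\<^sub>R u n)"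
      by (rule norm_triangle_ineq2)
    ultimately show ?thesis using W[of n] by simp
  qed
  have "summable (\<lambda>n. (1 / W n) powr p)"
  proof (rule summable_if_bounded_return_sums[OF dens, where C = "C powr p" and B = 2])
    show "1 \<le> C powr p" using C(1) p by (simp add: ge_one_powr_ge_zero)
    fix n
    have "W (Suc n) \<le> W n * C" unfolding W_def wprod_Suc using C(2) W[of n] by (simp add: W_def)
    then have "1 / W n \<le> C * (1 / W (Suc n))"
      using W[of n] W[of "Suc n"] by (simp add: field_simps)
    then have "(1 / W n) powr p \<le> (C * (1 / W (Suc n))) powr p"
      using W[of n] p by (intro powr_mono2) auto
    then show "(1 / W n) powr p \<le> C powr p * (1 / W (Suc n)) powr p"
      using C(1) W[of "Suc n"] by (simp add: powr_mult powr_divide)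
  next
    fix m J assume m: "m \<in> E"
    define S where "S = (\<Sum>j. norm (D m j) powr p)"
    have sD: "summable (\<lambda>j. norm (D m j) powr p)" using D(1)[OF m] by (simp add: lp_def)
    have "S = lp_norm p (D m) powr p" unfolding S_def by (rule lp_norm_powr[OF p D(1)[OF m], symmetric])
    also have "\<dots> \<le> (1 / 2) powr p" using D(2)[OF m] p by (intro powr_mono2) auto
    finally have S: "2 powr p * S \<le> 1" by (simp add: powr_divide field_simps)
    have *: "(1 / W j) powr p \<le> (if j = 0 then 1 else 0) + 2 powr p * norm (D m j) powr p"
      if "m + j \<in> E" for j
    proof (cases "j = 0")
      case True
      then show ?thesis by (simp add: W_def)
    next
      case False
      have "1 / W j \<le> 2 * (W (m + j) * norm (u (m + j)) / W j)"
        using big[OF that] W[of j] by (simp add: field_simps)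
      also have "W (m + j) * norm (u (m + j)) / W j = norm (D m j)"
        using False W[of j] W[of "m + j"] by (simp add: D_def b_def weighted_shift_funpow[OF w] W_def)
      finally have "(1 / W j) powr p \<le> (2 * norm (D m j)) powr p"
        using p W[of j] by (intro powr_mono2) auto
      then show ?thesis using False by (simp add: powr_mult)
    qed
    have "(\<Sum>j | j < J \<and> m + j \<in> E. (1 / W j) powr p)
        \<le> (\<Sum>j | j < J \<and> m + j \<in> E. (if j = 0 then 1 else 0) + 2 powr p * norm (D m j) powr p)"
      using * by (intro sum_mono) auto
    also have "\<dots> \<le> (\<Sum>j\<in>insert 0 {..<J}. (if j = 0 then 1 else 0) + 2 powr p * norm (D m j) powr p)"
      by (intro sum_mono2) auto
    also have "\<dots> = 1 + 2 powr p * (\<Sum>j\<in>insert 0 {..<J}. norm (D m j) powr p)"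
      by (simp only: sum.distrib sum_distrib_left) simp
    also have "\<dots> \<le> 1 + 2 powr p * S"
      unfolding S_def using sD by (intro add_left_mono mult_left_mono sum_le_suminf) auto
    finally show "(\<Sum>j | j < J \<and> m + j \<in> E. (1 / W j) powr p) \<le> 2" using S by simp
  qed simp
  then show ?thesis by (simp add: W_def)
qed

section \<open>A frequently hypercyclic vector with prescribed block positions\<close>

text \<open>The entries are scaled by \<open>1 / W j\<close> because that is how the shift reproduces a block of the
  sequence \<open>c\<close>; for fixed \<open>j\<close> a positive factor does not affect density of the values \<open>q n\<close>.\<close>

lemma finite_sequences_dense:
  fixes z :: "nat \<Rightarrow> 'a::real_normed_field"
  assumes p: "1 \<le> p" and W: "\<And>j. 0 < W j" and dense: "\<And>y \<epsilon>. 0 < \<epsilon> \<Longrightarrow> \<exists>n. norm (q n - y) < \<epsilon>"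
    and z: "z \<in> lp p" and \<delta>: "0 < \<delta>"
  obtains ns :: "nat list"
  where "lp_dist p z (\<lambda>j. if j < length ns then (1 / W j) *\<^sub>R q (ns ! j) else 0) < \<delta>"
proof -
  define r where "r = \<delta> powr p"
  have r: "0 < r" using \<delta> by (simp add: r_def)
  have s: "summable (\<lambda>j. norm (z j) powr p)" using z by (simp add: lp_def)
  have "(\<lambda>n. \<Sum>i. norm (z (i + n)) powr p) \<longlonglongrightarrow> 0" by (rule suminf_exist_split2[OF s])
  then have "\<forall>\<^sub>F n in sequentially. (\<Sum>i. norm (z (i + n)) powr p) < r / 2"
    using r by (intro order_tendstoD) auto
  then obtain L where L: "(\<Sum>i. norm (z (i + L)) powr p) < r / 2" by (auto simp: eventually_sequentially)
  define \<rho> where "\<rho> = (r / (2 * (real L + 1))) powr (1 / p)"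
  have \<rho>: "0 < \<rho>" "\<rho> powr p = r / (2 * (real L + 1))" using r p by (simp_all add: \<rho>_def powr_powr)
  have "\<exists>n. norm (q n - W j *\<^sub>R z j) < W j * \<rho>" for j using dense W \<rho> by simp
  then obtain f where f: "\<And>j. norm (q (f j) - W j *\<^sub>R z j) < W j * \<rho>" by metis
  define ns where "ns = map f [0..<L]"
  define t where "t j = (if j < length ns then (1 / W j) *\<^sub>R q (ns ! j) else 0)" for j
  have t: "t \<in> lp p" by (rule finite_support_in_lp[of L]) (simp add: t_def ns_def)
  have small: "norm (z j - t j) powr p \<le> r / (2 * (real L + 1))" if "j < L" for j
  proof -
    have "z j - t j = - ((1 / W j) *\<^sub>R (q (f j) - W j *\<^sub>R z j))"
      using W[of j] that by (simp add: t_def ns_def scaleR_diff_right)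
    then have "norm (z j - t j) = norm (q (f j) - W j *\<^sub>R z j) / W j" using W[of j] by simp
    also have "\<dots> \<le> \<rho>" using f[of j] W[of j] by (simp add: divide_le_eq mult.commute)
    finally have "norm (z j - t j) powr p \<le> \<rho> powr p" using p by (intro powr_mono2) auto
    then show ?thesis using \<rho> by simp
  qed
  have d: "(\<lambda>j. z j - t j) \<in> lp p" by (rule lp_diff[OF p z t])
  then have sd: "summable (\<lambda>j. norm (z j - t j) powr p)" by (simp add: lp_def)
  have "(\<Sum>j. norm (z j - t j) powr p)
      = (\<Sum>j. norm (z (j + L) - t (j + L)) powr p) + (\<Sum>j<L. norm (z j - t j) powr p)"
    by (rule suminf_split_initial_segment[OF sd])
  also have "(\<Sum>j. norm (z (j + L) - t (j + L)) powr p) = (\<Sum>j. norm (z (j + L)) powr p)"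
    by (simp add: t_def ns_def)
  also have "(\<Sum>j<L. norm (z j - t j) powr p) \<le> (\<Sum>j<L. r / (2 * (real L + 1)))"
    using small by (intro sum_mono) auto
  also have "\<dots> \<le> r / 2" using r by (simp add: field_simps)
  finally have "(\<Sum>j. norm (z j - t j) powr p) < \<delta> powr p" using L by (simp add: r_def)
  then have "lp_dist p z t < \<delta>" unfolding lp_dist_def by (intro lp_norm_lessI[OF p \<delta> d])
  then show ?thesis by (intro that[of ns]) (simp add: t_def[abs_def])
qed

text \<open>Blocks that start in different places do not overlap, so writing \<open>cs k\<close> from each position in \<open>E k\<close>
  on, and zeros elsewhere, is unambiguous.\<close>

lemma superpose_blocks:
  fixes E :: "nat \<Rightarrow> nat set" and cs :: "nat \<Rightarrow> 'a::zero list"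
  assumes gap: "\<And>k l m n. m \<in> E k \<Longrightarrow> n \<in> E l \<Longrightarrow> m < n \<Longrightarrow> m + length (cs k) \<le> n"
    and disj: "\<And>k l n. n \<in> E k \<Longrightarrow> n \<in> E l \<Longrightarrow> k = l"
  obtains c where "\<And>k n i. n \<in> E k \<Longrightarrow> i < length (cs k) \<Longrightarrow> c (n + i) = cs k ! i"
    "\<And>m. c m \<noteq> 0 \<Longrightarrow> \<exists>k n i. n \<in> E k \<and> i < length (cs k) \<and> m = n + i"
proof -
  define P where "P m t \<longleftrightarrow> (case t of (k, n, i) \<Rightarrow> n \<in> E k \<and> i < length (cs k) \<and> m = n + i)" for m t
  have uniq: "t = t'" if "P m t" "P m t'" for m t t'
  proof -
    obtain k n i k' n' i' where t: "t = (k, n, i)" "t' = (k', n', i')" by (metis prod_cases3)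
    have "n = n'"
    proof (cases n n' rule: linorder_cases)
      case less
      then show ?thesis using gap[of n k n' k'] that by (auto simp: P_def t)
    next
      case greater
      then show ?thesis using gap[of n' k' n k] that by (auto simp: P_def t)
    qed
    then show ?thesis using disj[of n k k'] that by (auto simp: P_def t)
  qed
  define c where "c m = (if \<exists>t. P m t then case (THE t. P m t) of (k, n, i) \<Rightarrow> cs k ! i else 0)" for m
  show ?thesis
  proof
    fix k n i assume "n \<in> E k" "i < length (cs k)"
    then have "P (n + i) (k, n, i)" by (simp add: P_def)
    moreover from this have "(THE t. P (n + i) t) = (k, n, i)" using uniq by blast
    ultimately show "c (n + i) = cs k ! i" unfolding c_def by auto
  next
    fix m assume "c m \<noteq> 0"
    then have "\<exists>t. P m t" unfolding c_def by meson
    then show "\<exists>k n i. n \<in> E k \<and> i < length (cs k) \<and> m = n + i" by (auto simp: P_def)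
  qed
qed

text \<open>Enumerate all finite blocks of values \<open>q i\<close>, each one infinitely often, and write block \<open>k\<close> at the
  positions in a separated set \<open>E k \<subseteq> F (cs k)\<close>. At a time \<open>n \<in> E k\<close> the iterate reproduces block
  \<open>k\<close> exactly; the error comes from later blocks, each seen at a distance \<open>j\<close> at which \<open>G j\<close> already
  dominates its entries. Hence its \<open>p\<close>-th power is at most the tail of \<open>\<Sum>j. G j * v j\<close> from \<open>N k\<close> on, which
  tends to \<open>0\<close>; a target sequence is approximated by taking a late occurrence of a suitable block
  in the enumeration.\<close>

lemma FHC_vector_with_prescribed_positions:
  fixes F :: "'a::real_normed_field list \<Rightarrow> nat set" and q :: "nat \<Rightarrow> 'a"
  assumes p: "1 \<le> p" and w: "\<forall>k\<ge>1. w k > 0"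
    and sum: "summable (\<lambda>n. (1 / wprod w n) powr p)"
    and dense: "\<And>y \<epsilon>. 0 < \<epsilon> \<Longrightarrow> \<exists>n. norm (q n - y) < \<epsilon>"
    and F: "\<And>cs. lower_density (F cs) > 0"
  obtains c where "(\<lambda>m. (1 / wprod w m) *\<^sub>R c m) \<in> FHC p (weighted_shift w)"
    "\<And>m. c m \<noteq> 0 \<Longrightarrow> M \<le> m \<and> (\<exists>cs n i. n \<in> F cs \<and> i < length cs \<and> m = n + i \<and> c m = cs ! i)"
proof -
  define W where "W = wprod w"
  have W: "0 < W n" for n using wprod_pos[OF w] by (simp add: W_def)
  define v where "v n = (1 / W n) powr p" for n
  have v: "0 < v n" for n using W[of n] by (simp add: v_def)
  have "summable v" using sum by (simp add: v_def[abs_def] W_def)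
  then obtain G where G: "filterlim G at_top sequentially" "\<And>n. 0 < G n" "summable (\<lambda>n. G n * v n)"
    using summable_slow_multiplier[of v] v by metis
  define g where "g n = G n * v n" for n
  have g: "0 \<le> g n" "summable g" for n using G v by (auto simp: g_def[abs_def] less_imp_le)
  define cs where "cs k = map q (fst (from_nat k :: nat list \<times> nat))" for k
  define b where "b k = (\<Sum>i<length (cs k). norm (cs k ! i) powr p)" for k
  have b: "norm (cs k ! i) powr p \<le> b k" if "i < length (cs k)" for k i
    unfolding b_def using that by (intro member_le_sum[of i "{..<length (cs k)}" "\<lambda>i. norm (cs k ! i) powr p"]) auto
  (* N k is the distance that block k keeps to all other blocks and to position 0. *)
  have "\<exists>N. (\<forall>j\<ge>N. b k \<le> G j) \<and> length (cs k) \<le> N \<and> k \<le> N \<and> M \<le> N" for k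
  proof -
    have "\<forall>\<^sub>F j in sequentially. b k \<le> G j" using G(1) by (simp add: filterlim_at_top)
    then obtain N where "\<forall>j\<ge>N. b k \<le> G j" by (auto simp: eventually_sequentially)
    then show ?thesis by (intro exI[of _ "N + length (cs k) + k + M"]) auto
  qed
  then obtain N where NG: "\<And>k j. N k \<le> j \<Longrightarrow> b k \<le> G j" and Nlen: "\<And>k. length (cs k) \<le> N k"
    and Nk: "\<And>k. k \<le> N k" and NM: "\<And>k. M \<le> N k" by metis
  obtain E where EF: "\<And>k. E k \<subseteq> F (cs k)" and Ed: "\<And>k. lower_density (E k) > 0"
    and EN: "\<And>k n. n \<in> E k \<Longrightarrow> N k \<le> n"
    and gap: "\<And>k l m n. m \<in> E k \<Longrightarrow> n \<in> E l \<Longrightarrow> m < n \<Longrightarrow> m + N k \<le> n \<and> m + N l \<le> n"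
    and disj: "\<And>k l n. n \<in> E k \<Longrightarrow> n \<in> E l \<Longrightarrow> k = l"
    by (rule separated_subsets[of "\<lambda>k. F (cs k)" N, OF F], rule that)
  obtain c where c: "\<And>k n i. n \<in> E k \<Longrightarrow> i < length (cs k) \<Longrightarrow> c (n + i) = cs k ! i"
    and supp: "\<And>m. c m \<noteq> 0 \<Longrightarrow> \<exists>k n i. n \<in> E k \<and> i < length (cs k) \<and> m = n + i"
  proof (rule superpose_blocks[of E cs])
    show "m + length (cs k) \<le> n" if "m \<in> E k" "n \<in> E l" "m < n" for k l m n
      using gap[OF that] Nlen[of k] by simp
    show "k = l" if "n \<in> E k" "n \<in> E l" for k l n
      using that by (rule disj)
  qed (rule that)
  define x where "x m = (1 / W m) *\<^sub>R c m" for m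
  have norm_scaled: "norm ((1 / W j) *\<^sub>R y) powr p = norm y powr p * v j" for j and y :: 'a
    using W[of j] by (simp add: v_def powr_mult mult.commute powr_divide)
  have x: "x \<in> lp p"
    unfolding lp_def mem_Collect_eq
  proof (rule summable_comparison_test'[OF g(2)])
    fix m :: nat
    have "norm (c m) powr p \<le> G m"
    proof (cases "c m = 0")
      case False
      then obtain k n i where kni: "n \<in> E k" "i < length (cs k)" "m = n + i" using supp by blast
      have "norm (c m) powr p \<le> b k" using b[OF kni(2)] c[OF kni(1,2)] kni(3) by simp
      also have "\<dots> \<le> G m" using EN[OF kni(1)] kni(3) by (intro NG) simp
      finally show ?thesis .
    qed (use G(2)[of m] in simp)
    then show "norm (norm (x m) powr p) \<le> g m"
      unfolding x_def norm_scaled g_def using v[of m] by (simp add: mult_right_mono)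
  qed
  have approx: "(weighted_shift w ^^ n) x \<in> lp p \<and>
      lp_dist p (\<lambda>j. if j < length (cs k) then (1 / W j) *\<^sub>R (cs k ! j) else 0) ((weighted_shift w ^^ n) x) < r"
    if n: "n \<in> E k" and r: "0 < r" and tail: "(\<Sum>j. g (j + N k)) < r powr p" for n k r
  proof -
    define t where "t j = (if j < length (cs k) then (1 / W j) *\<^sub>R (cs k ! j) else 0)" for j
    define y where "y = (weighted_shift w ^^ n) x"
    have y: "y j = (1 / W j) *\<^sub>R c (n + j)" for j
      using W[of "n + j"] by (simp add: y_def weighted_shift_funpow[OF w] x_def flip: W_def)
    define h where "h j = (if N k \<le> j then g j else 0)" for j
    have diff: "norm (t j - y j) powr p \<le> h j" for j
    proof (cases "j < length (cs k)")
      case True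
      then show ?thesis using c[OF n True] g(1) by (simp add: t_def y h_def)
    next
      case False
      then have *: "norm (t j - y j) powr p = norm (c (n + j)) powr p * v j"
        unfolding t_def y by (simp add: norm_scaled del: norm_scaleR)
      show ?thesis
      proof (cases "c (n + j) = 0")
        case True
        then show ?thesis using * g(1) by (simp add: h_def)
      next
        case nz: False
        then obtain l m i where lmi: "m \<in> E l" "i < length (cs l)" "n + j = m + i" using supp by blast
        (* A non-zero entry outside the block at n belongs to a block that starts after n. *)
        have "m \<noteq> n" using disj[of n k l] n lmi False by auto
        moreover have "\<not> m < n" using gap[OF lmi(1) n] lmi Nlen[of l] by auto
        ultimately have "n < m" by simp
        then have "n + N k \<le> m" "n + N l \<le> m" using gap[OF n lmi(1)] by auto
        then have j: "N k \<le> j" "N l \<le> j" using lmi(3) by auto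
        have "norm (c (n + j)) powr p \<le> b l" using b[OF lmi(2)] c[OF lmi(1,2)] lmi(3) by simp
        also have "\<dots> \<le> G j" using j(2) by (rule NG)
        finally show ?thesis unfolding * h_def g_def using j(1) v[of j] by (simp add: mult_right_mono)
      qed
    qed
    have h: "summable h"
      by (rule summable_comparison_test'[OF g(2)]) (use g(1) in \<open>auto simp: h_def\<close>)
    have d: "(\<lambda>j. t j - y j) \<in> lp p"
      unfolding lp_def mem_Collect_eq by (rule summable_comparison_test'[OF h]) (use diff in simp)
    have t: "t \<in> lp p" by (rule finite_support_in_lp[of "length (cs k)"]) (simp add: t_def)
    have "(\<lambda>j. t j - (t j - y j)) \<in> lp p" by (rule lp_diff[OF p t d])
    then have ylp: "y \<in> lp p" by simp
    have "(\<Sum>j. norm (t j - y j) powr p) \<le> (\<Sum>j. h j)"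
      using d by (intro suminf_le[OF diff _ h]) (simp add: lp_def)
    also have "\<dots> = (\<Sum>j. h (j + N k)) + (\<Sum>j<N k. h j)"
      by (rule suminf_split_initial_segment[OF h])
    also have "\<dots> = (\<Sum>j. g (j + N k))" by (simp add: h_def)
    finally have "(\<Sum>j. norm (t j - y j) powr p) < r powr p" using tail by simp
    then have "lp_dist p t y < r" unfolding lp_dist_def by (intro lp_norm_lessI[OF p r d])
    then show ?thesis using ylp by (simp add: t_def[abs_def] y_def)
  qed
  have "x \<in> FHC p (weighted_shift w)"
    unfolding FHC_def mem_Collect_eq
  proof (intro conjI allI impI x)
    fix U :: "(nat \<Rightarrow> 'a) set" assume U: "openin (lp_topology p) U \<and> U \<noteq> {}"
    then obtain z where z: "z \<in> U" by blast
    obtain r where r: "0 < r" "\<And>y. y \<in> lp p \<Longrightarrow> lp_dist p z y < r \<Longrightarrow> y \<in> U" "z \<in> lp p"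
      using openin_lp_contains_ball[OF p _ z] U by blast
    obtain ns where ns: "lp_dist p z (\<lambda>j. if j < length ns then (1 / W j) *\<^sub>R q (ns ! j) else 0) < r / 2"
      using finite_sequences_dense[where q = q and W = W and \<delta> = "r / 2", OF p W dense r(3)] r(1) by auto
    have "(\<lambda>n. \<Sum>i. g (i + n)) \<longlonglongrightarrow> 0" by (rule suminf_exist_split2[OF g(2)])
    then have "\<forall>\<^sub>F n in sequentially. (\<Sum>i. g (i + n)) < (r / 2) powr p"
      using r(1) by (intro order_tendstoD) auto
    then obtain K where K: "\<And>n. K \<le> n \<Longrightarrow> (\<Sum>i. g (i + n)) < (r / 2) powr p"
      by (auto simp: eventually_sequentially)
    (* The second component of the code is free, so ns has codes beyond K. *)
    have "infinite (range (\<lambda>i::nat. to_nat (ns, i)))"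
      by (rule range_inj_infinite) (auto intro!: injI)
    then have "\<exists>k\<ge>K. k \<in> range (\<lambda>i::nat. to_nat (ns, i))"
      unfolding infinite_nat_iff_unbounded_le by simp
    then obtain i where i: "K \<le> to_nat (ns, i :: nat)" by auto
    define k where "k = to_nat (ns, i)"
    have csk: "cs k = map q ns" by (simp add: cs_def k_def)
    have tail: "(\<Sum>j. g (j + N k)) < (r / 2) powr p" using i Nk[of k] by (intro K) (simp add: k_def)
    define t where "t j = (if j < length (cs k) then (1 / W j) *\<^sub>R (cs k ! j) else 0)" for j
    have t: "t \<in> lp p" by (rule finite_support_in_lp[of "length (cs k)"]) (simp add: t_def)
    have "t = (\<lambda>j. if j < length ns then (1 / W j) *\<^sub>R q (ns ! j) else 0)"
      by (auto simp: t_def csk)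
    then have zt: "lp_dist p z t < r / 2" using ns by simp
    have "E k \<subseteq> {n. (weighted_shift w ^^ n) x \<in> U}"
    proof
      fix n assume "n \<in> E k"
      then have y: "(weighted_shift w ^^ n) x \<in> lp p" "lp_dist p t ((weighted_shift w ^^ n) x) < r / 2"
        using approx[of n k "r / 2"] r(1) tail by (simp_all add: t_def[abs_def])
      have "lp_dist p z ((weighted_shift w ^^ n) x) \<le> lp_dist p z t + lp_dist p t ((weighted_shift w ^^ n) x)"
        by (rule Metric_space.triangle[OF Metric_space_lp[OF p] r(3) t y(1)])
      then show "n \<in> {n. (weighted_shift w ^^ n) x \<in> U}" using zt y r(2) by simp
    qed
    then show "lower_density {n. (weighted_shift w ^^ n) x \<in> U} > 0"
      by (rule lower_density_pos_mono[OF Ed])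
  qed
  moreover have "M \<le> m \<and> (\<exists>cs n i. n \<in> F cs \<and> i < length cs \<and> m = n + i \<and> c m = cs ! i)"
    if nz: "c m \<noteq> 0" for m
  proof -
    obtain k n i where kni: "n \<in> E k" "i < length (cs k)" "m = n + i" using supp[OF nz] by blast
    have "M \<le> m" using NM[of k] EN[OF kni(1)] kni(3) by simp
    moreover have "n \<in> F (cs k)" "c m = cs k ! i" using EF kni c by auto
    ultimately show ?thesis using kni by blast
  qed
  ultimately show ?thesis by (intro that[of c]) (simp_all add: x_def[abs_def] W_def)
qed

section \<open>Separating the two shifts\<close>

text \<open>In both cases \<open>c\<close> and \<open>R\<close> are apart by a fixed amount. The division by \<open>R\<close> is harmless because either
  \<open>R \<le> 2 * a\<close>, or \<open>R\<close> is large and then the distance from \<open>c\<close>, which is near \<open>a\<close>, grows in proportion to \<open>R\<close>.\<close>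

lemma relative_distance_lower_bound:
  fixes c :: "'a::real_normed_field" and R a \<eta> :: real
  assumes R: "0 < R" and \<eta>: "0 < \<eta>" "\<eta> < a"
    and far: "\<bar>R - a\<bar> < \<eta> / 4 \<and> \<eta> / 2 \<le> norm (c - of_real a) \<or>
      \<eta> < \<bar>R - a\<bar> \<and> norm (c - of_real a) < \<eta> / 2"
  shows "\<eta> / (8 * a) \<le> norm ((1 / R) *\<^sub>R c - 1)"
proof -
  have "(1 / R) *\<^sub>R c - 1 = (1 / R) *\<^sub>R (c - of_real R)"
    using R by (simp add: scaleR_conv_of_real field_simps)
  then have eq: "norm ((1 / R) *\<^sub>R c - 1) = norm (c - of_real R) / R" using R by simp
  have dist: "norm (of_real R - of_real a :: 'a) = \<bar>R - a\<bar>" by (simp flip: of_real_diff)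
  have ge: "\<eta> * R \<le> norm (c - of_real R) * (8 * a)"
    using far
  proof
    assume near: "\<bar>R - a\<bar> < \<eta> / 4 \<and> \<eta> / 2 \<le> norm (c - of_real a)"
    have "norm (c - of_real a) \<le> norm (c - of_real R) + norm (of_real R - of_real a :: 'a)"
      by (rule norm_diff_triangle_ineq[of c "of_real R" "of_real R" "of_real a", simplified])
    then have "\<eta> / 4 \<le> norm (c - of_real R)" using near dist by linarith
    moreover have "R \<le> 2 * a" using near \<eta> by linarith
    ultimately have "R * (\<eta> / 4) \<le> (2 * a) * norm (c - of_real R)"
      using \<eta> by (intro mult_mono) auto
    then show ?thesis by (simp add: mult_ac)
  next
    assume away: "\<eta> < \<bar>R - a\<bar> \<and> norm (c - of_real a) < \<eta> / 2"
    have "norm (of_real R - of_real a :: 'a) \<le> norm (of_real R - c) + norm (c - of_real a)"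
      by (rule norm_diff_triangle_ineq[of "of_real R" c c "of_real a", simplified])
    then have half: "\<bar>R - a\<bar> / 2 \<le> norm (c - of_real R)"
      using away dist by (simp add: norm_minus_commute)
    have "\<eta> * R \<le> 2 * a * \<bar>R - a\<bar>"
    proof (cases "R \<le> a")
      case True
      then have "\<eta> * R \<le> \<bar>R - a\<bar> * a" using away R \<eta> by (intro mult_mono) auto
      also have "\<dots> \<le> 2 * a * \<bar>R - a\<bar>" using \<eta> by (simp add: mult_ac)
      finally show ?thesis .
    next
      case False
      then have "\<eta> * a \<le> (R - a) * a" "\<eta> * (R - a) \<le> a * (R - a)"
        using away \<eta> by (auto intro!: mult_right_mono)
      moreover have "\<eta> * R = \<eta> * a + \<eta> * (R - a)" by (simp add: algebra_simps)
      ultimately show ?thesis using False by (simp add: algebra_simps)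
    qed
    also have "\<dots> \<le> 4 * a * norm (c - of_real R)"
      using mult_left_mono[OF half, of "4 * a"] \<eta> by simp
    also have "\<dots> \<le> norm (c - of_real R) * (8 * a)" using \<eta> by (simp add: mult_ac)
    finally show ?thesis .
  qed
  then show ?thesis unfolding eq using R \<eta> by (simp add: field_simps)
qed

theorem proposition4p9:
  fixes p a \<eta> :: real
    and w w' :: "nat \<Rightarrow> real"
    and A :: "nat set"
  assumes "1 \<le> p"
    and "\<forall>k\<ge>1. w k > 0" and "\<forall>k\<ge>1. w' k > 0"
    and "lp_bounded p (weighted_shift w :: (nat \<Rightarrow> 'a::real_normed_field) \<Rightarrow> nat \<Rightarrow> 'a)"
    and "lp_bounded p (weighted_shift w' :: (nat \<Rightarrow> 'a) \<Rightarrow> nat \<Rightarrow> 'a)"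
    and "frequently_hypercyclic p (weighted_shift w :: (nat \<Rightarrow> 'a) \<Rightarrow> nat \<Rightarrow> 'a)"
    and "frequently_hypercyclic p (weighted_shift w' :: (nat \<Rightarrow> 'a) \<Rightarrow> nat \<Rightarrow> 'a)"
    and "A \<subseteq> {1..}" and "infinite A" and "infinite ({1..} - A)"
    and "((\<lambda>n. (\<Prod>k=1..n. w k) / (\<Prod>k=1..n. w' k)) \<longlongrightarrow> a) (inf sequentially (principal A))"
    and "a \<noteq> 0"
    and "\<eta> > 0" and "\<bar>a\<bar> - \<eta> > 0"
    and "\<exists>N. \<forall>n\<in>{1..} - A. n \<ge> N \<longrightarrow> \<bar>(\<Prod>k=1..n. w k) / (\<Prod>k=1..n. w' k) - a\<bar> > \<eta>"
    and "\<forall>(k::nat) (b :: nat \<Rightarrow> nat). (\<forall>i\<le>k. b i \<in> {0, 1}) \<and> (\<exists>i\<le>k. b i = 0) \<longrightarrow>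
           lower_density {n. n \<ge> 1 \<and> (\<forall>i\<le>k. n + i \<in> A \<longleftrightarrow> b i = 0)} > 0"
  shows "\<exists>x :: nat \<Rightarrow> 'a. x \<in> FHC p (weighted_shift w) \<and> x \<notin> HC p (weighted_shift w')"
proof -
  note p = assms(1) and w = assms(2) and w' = assms(3)
  define R where "R n = wprod w n / wprod w' n" for n
  have R: "0 < R n" for n using wprod_pos[OF w] wprod_pos[OF w'] by (simp add: R_def)
  have lim: "(R \<longlongrightarrow> a) (inf sequentially (principal A))"
    using assms(11) by (simp add: R_def[abs_def] wprod_def)
  have nontrivial: "inf sequentially (principal A) \<noteq> bot"
    using \<open>infinite A\<close> unfolding trivial_limit_def eventually_inf_principal
    by (auto simp: eventually_sequentially infinite_nat_iff_unbounded_le)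
  have "0 \<le> a"
    by (rule tendsto_lowerbound[OF lim _ nontrivial]) (simp add: R less_imp_le)
  then have \<eta>: "0 < \<eta>" "\<eta> < a" using assms(13,14) by auto
  have "\<forall>\<^sub>F n in inf sequentially (principal A). \<bar>R n - a\<bar> < \<eta> / 4"
    using tendstoD[OF lim, of "\<eta> / 4"] \<eta> by (simp add: dist_real_def)
  then obtain N1 where N1: "\<And>n. N1 \<le> n \<Longrightarrow> n \<in> A \<Longrightarrow> \<bar>R n - a\<bar> < \<eta> / 4"
    unfolding eventually_inf_principal by (auto simp: eventually_sequentially)
  obtain N2 where N2: "\<And>n. N2 \<le> n \<Longrightarrow> 1 \<le> n \<Longrightarrow> n \<notin> A \<Longrightarrow> \<eta> < \<bar>R n - a\<bar>"
    using assms(15) unfolding R_def wprod_def by auto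
  obtain u :: "nat \<Rightarrow> 'a" where u: "u \<in> FHC p (weighted_shift w)"
    using assms(6) unfolding frequently_hypercyclic_def by blast
  define near where "near y \<longleftrightarrow> norm (y - of_real a) < \<eta> / 2" for y :: 'a
  (* The index i = length cs is always mapped to 0, so the pattern contains a zero. *)
  define F where "F cs = {n. n \<ge> 1 \<and> (\<forall>i\<le>length cs. n + i \<in> A \<longleftrightarrow>
      (if i < length cs \<and> near (cs ! i) then 1 else 0 :: nat) = 0)}" for cs :: "'a list"
  have F: "lower_density (F cs) > 0" for cs
    unfolding F_def by (rule assms(16)[rule_format]) auto
  (* Blocks start beyond N1 and N2, so that the estimates for R hold at every non-zero entry. *)
  obtain c where c: "(\<lambda>m. (1 / wprod w m) *\<^sub>R c m) \<in> FHC p (weighted_shift w)"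
    and supp: "\<And>m. c m \<noteq> 0 \<Longrightarrow> N1 + N2 + 1 \<le> m \<and>
        (\<exists>cs n i. n \<in> F cs \<and> i < length cs \<and> m = n + i \<and> c m = cs ! i)"
  proof (rule FHC_vector_with_prescribed_positions[of p w "\<lambda>n. wprod w n *\<^sub>R u n" F "N1 + N2 + 1"])
    show "summable (\<lambda>n. (1 / wprod w n) powr p)"
      by (rule FHC_shift_imp_summable[OF p w assms(4) u])
    show "\<exists>n. norm (wprod w n *\<^sub>R u n - y) < \<epsilon>" if "0 < \<epsilon>" for y \<epsilon>
      using that by (rule FHC_scalars_dense[OF p w u])
  qed (rule p w F that)+
  define x where "x m = (1 / wprod w m) *\<^sub>R c m" for m
  have "\<eta> / (8 * a) \<le> norm ((1 / R m) *\<^sub>R c m - 1)" for m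
  proof (cases "c m = 0")
    case True
    then show ?thesis using \<eta> by simp
  next
    case False
    then obtain cs n i where m: "N1 + N2 + 1 \<le> m" "n \<in> F cs" "i < length cs" "m = n + i" "c m = cs ! i"
      using supp by blast
    then have "m \<in> A \<longleftrightarrow> \<not> near (c m)" by (auto simp: F_def)
    then show ?thesis
      using N1[of m] N2[of m] m(1)
      by (intro relative_distance_lower_bound R \<eta>) (auto simp: near_def)
  qed
  moreover have "(weighted_shift w' ^^ m) x 0 = (1 / R m) *\<^sub>R c m" for m
    by (simp add: weighted_shift_funpow[OF w'] x_def R_def)
  ultimately have "x \<notin> HC p (weighted_shift w')"
    using \<eta> by (intro notin_HC_if_coordinate_avoids[OF p, of "\<eta> / (8 * a)" _ x 1]) simp_all
  moreover have "x \<in> FHC p (weighted_shift w)" using c by (simp add: x_def[abs_def])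
  ultimately show ?thesis by blast
qed

end
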